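(* Let $\mathcal H$ be a complex Hilbert space and let $T\in\mathcal B(\mathcal H)$ be a $2$-isometry such that $T^*T(\ker T^* )\subseteq \ker T^*$. Then the Cauchy dual $T'$ is a subnormal contraction, $T'^*T'(\ker T'^* )\subseteq\ker T'^*$, and $$T'^{*n}T'^{n}=\big(nT^*T-(n-1)I\big)^{-1}=(T^{*n}T^n)^{-1},\qquad n=0,1,2,\ldots.$$
   Context: An operator $T\in\mathcal B(\mathcal H)$ is a $2$-isometry if $I-2T^*T+T^{*2}T^2=0$. Every $2$-isometry is left-invertible (indeed $\|Tf\|\ge\|f\|$), so $T^*T$ is invertible. For a left-invertible $T$, the Cauchy dual of $T$ is $T'=T(T^*T)^{-1}$. $T$ satisfies the kernel condition if $T^*T(\ker T^* )\subseteq\ker T^*$. An operator $S$ is subnormal if it is the restriction of a normal operator on a larger Hilbert space to an invariant subspace. *)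

theory Defs
  imports "HOL-Analysis.Analysis"
begin

class complex_vector = real_vector +
  fixes scaleC :: "complex \<Rightarrow> 'a \<Rightarrow> 'a" (infixr \<open>*\<^sub>C\<close> 75)
  assumes scaleC_add_right: "a *\<^sub>C (x + y) = a *\<^sub>C x + a *\<^sub>C y"
    and scaleC_add_left: "(a + b) *\<^sub>C x = a *\<^sub>C x + b *\<^sub>C x"
    and scaleC_scaleC: "a *\<^sub>C (b *\<^sub>C x) = (a * b) *\<^sub>C x"
    and scaleC_one: "1 *\<^sub>C x = x"
    and scaleC_of_real: "complex_of_real r *\<^sub>C x = r *\<^sub>R x"

class complex_inner = complex_vector + real_normed_vector +
  fixes cinner :: "'a \<Rightarrow> 'a \<Rightarrow> complex"
  assumes cinner_commute: "cinner x y = cnj (cinner y x)"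
    and cinner_add_left: "cinner (x + y) z = cinner x z + cinner y z"
    and cinner_scaleC_left: "cinner (a *\<^sub>C x) y = a * cinner x y"
    and cinner_ge_zero: "0 \<le> Re (cinner x x)"
    and norm_eq_sqrt_cinner: "norm x = sqrt (Re (cinner x x))"

class chilbert_space = complex_inner + complete_space

definition bounded_clinear :: "('a::complex_inner \<Rightarrow> 'b::complex_inner) \<Rightarrow> bool" where
  "bounded_clinear T \<longleftrightarrow>
     (\<forall>x y. T (x + y) = T x + T y) \<and> (\<forall>c x. T (c *\<^sub>C x) = c *\<^sub>C T x) \<and>
     (\<exists>K. \<forall>x. norm (T x) \<le> norm x * K)"

text \<open>The Hilbert-space adjoint (it exists and is unique for bounded operators
  on a Hilbert space).\<close>
definition adj :: "('a::complex_inner \<Rightarrow> 'a) \<Rightarrow> ('a \<Rightarrow> 'a)" where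
  "adj T = (SOME S. \<forall>x y. cinner (T x) y = cinner x (S y))"

definition is_inverse_of :: "('a \<Rightarrow> 'a) \<Rightarrow> ('a \<Rightarrow> 'a) \<Rightarrow> bool" where
  "is_inverse_of B A \<longleftrightarrow> A \<circ> B = id \<and> B \<circ> A = id"

definition two_isometry :: "('a::complex_inner \<Rightarrow> 'a) \<Rightarrow> bool" where
  "two_isometry T \<longleftrightarrow>
     (\<forall>x. x - 2 *\<^sub>C adj T (T x) + adj T (adj T (T (T x))) = 0)"

definition kernel_condition :: "('a::complex_inner \<Rightarrow> 'a) \<Rightarrow> bool" where
  "kernel_condition T \<longleftrightarrow> (\<forall>x. adj T x = 0 \<longrightarrow> adj T (adj T (T x)) = 0)"

text \<open>Cauchy dual \<open>T' = T(T\<^sup>*T)\<^sup>-\<^sup>1\<close> (for left-invertible \<open>T\<close>, \<open>T\<^sup>*T\<close> is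
  invertible, so the function inverse is the operator inverse).\<close>
definition cauchy_dual :: "('a::complex_inner \<Rightarrow> 'a) \<Rightarrow> ('a \<Rightarrow> 'a)" where
  "cauchy_dual T = T \<circ> inv (adj T \<circ> T)"

definition contraction :: "('a::complex_inner \<Rightarrow> 'a) \<Rightarrow> bool" where
  "contraction T \<longleftrightarrow> (\<forall>x. norm (T x) \<le> norm x)"

definition l2seq :: "(nat \<Rightarrow> 'a::complex_inner) set" where
  "l2seq = {f. summable (\<lambda>n. (norm (f n))\<^sup>2)}"

definition l2inner :: "(nat \<Rightarrow> 'a::complex_inner) \<Rightarrow> (nat \<Rightarrow> 'a) \<Rightarrow> complex" where
  "l2inner f g = (\<Sum>n. cinner (f n) (g n))"

definition l2norm :: "(nat \<Rightarrow> 'a::complex_inner) \<Rightarrow> real" where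
  "l2norm f = sqrt (\<Sum>n. (norm (f n))\<^sup>2)"

definition normal_op_l2 :: "((nat \<Rightarrow> 'a::complex_inner) \<Rightarrow> (nat \<Rightarrow> 'a)) \<Rightarrow> bool" where
  "normal_op_l2 N \<longleftrightarrow>
     (\<forall>f\<in>l2seq. N f \<in> l2seq) \<and>
     (\<forall>f\<in>l2seq. \<forall>g\<in>l2seq. N (\<lambda>n. f n + g n) = (\<lambda>n. N f n + N g n)) \<and>
     (\<forall>f\<in>l2seq. \<forall>c. N (\<lambda>n. c *\<^sub>C f n) = (\<lambda>n. c *\<^sub>C N f n)) \<and>
     (\<exists>K. \<forall>f\<in>l2seq. l2norm (N f) \<le> K * l2norm f) \<and>
     (\<exists>Nadj. (\<forall>g\<in>l2seq. Nadj g \<in> l2seq) \<and>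
        (\<forall>f\<in>l2seq. \<forall>g\<in>l2seq. l2inner (N f) g = l2inner f (Nadj g)) \<and>
        (\<forall>f\<in>l2seq. N (Nadj f) = Nadj (N f)))"

definition subnormal_op :: "('a::chilbert_space \<Rightarrow> 'a) \<Rightarrow> bool" where
  "subnormal_op S \<longleftrightarrow>
     bounded_clinear S \<and>
     (\<exists>(V::'a \<Rightarrow> nat \<Rightarrow> 'a) N. (\<forall>x. V x \<in> l2seq) \<and>
        (\<forall>x y. V (x + y) = (\<lambda>n. V x n + V y n)) \<and>
        (\<forall>c x. V (c *\<^sub>C x) = (\<lambda>n. c *\<^sub>C V x n)) \<and>
        (\<forall>x y. l2inner (V x) (V y) = cinner x y) \<and>
        normal_op_l2 N \<and>
        (\<forall>x. N (V x) = V (S x)))"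

end

theory Submission
  imports Defs
begin

text \<open>
  Put \<open>A = T\<^sup>*T\<close>, \<open>B = A\<^sup>-\<^sup>1 = T'\<^sup>*T'\<close>, so \<open>T' = T B\<close>. Since \<open>I - T B T\<^sup>*\<close> projects onto \<open>ker T\<^sup>*\<close>, the
  kernel condition together with \<open>T\<^sup>*A T = 2 A - I\<close> gives \<open>A T = T (2 - B)\<close>. With
  \<open>A\<^sub>n = n A - (n - 1) I = T\<^sup>*\<^sup>n T\<^sup>n\<close> this reads \<open>T' A\<^sub>n\<^sub>+\<^sub>1 = A\<^sub>n T\<close>, whence
  \<open>T'\<^sup>*\<^sup>n T'\<^sup>n A\<^sub>n = I\<close> by induction.

  For subnormality, the Berger measures of \<open>1 / (1 + n s)\<close>, \<open>s = A - I\<close>, suggest embedding \<open>x\<close> into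
  \<open>L\<^sup>2(0, \<infinity>; H)\<close> as \<open>y \<mapsto> s\<^sup>-\<^sup>1\<^sup>/\<^sup>2 exp (- s\<^sup>-\<^sup>1 y / 2) x\<close> (the part on \<open>ker s\<close>, where \<open>T\<close> is isometric,
  being kept separately): there \<open>T'\<close> becomes multiplication by \<open>exp (- y / 2)\<close> tensored with the
  isometry \<open>W = T B\<^sup>1\<^sup>/\<^sup>2\<close>. In the basis of Laguerre functions the embedding has the
  coefficients \<open>2 (B (I - B))\<^sup>1\<^sup>/\<^sup>2 (2 B - I)\<^sup>k x\<close>, and the multiplication operator becomes a
  symmetric stochastic matrix, so everything can be verified algebraically in
  \<open>\<ell>\<^sup>2(\<nat>; H)\<close>. Replacing \<open>W\<close> by a unitary extension yields the normal operator.
\<close>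

instance chilbert_space \<subseteq> banach ..

section \<open>Complex inner product spaces\<close>

lemma cinner_add_right: "cinner x (y + z) = cinner x y + cinner x z"
  by (metis cinner_add_left cinner_commute complex_cnj_add)

lemma cinner_scaleC_right: "cinner x (a *\<^sub>C y) = cnj a * cinner x y"
  by (metis cinner_commute cinner_scaleC_left complex_cnj_mult)

lemma cinner_scaleR_left: "cinner (r *\<^sub>R x) y = r *\<^sub>R cinner x y"
  by (metis cinner_scaleC_left scaleC_of_real scaleR_conv_of_real)

lemma cinner_scaleR_right: "cinner x (r *\<^sub>R y) = r *\<^sub>R cinner x y"
  by (metis cinner_scaleC_right scaleC_of_real scaleR_conv_of_real complex_cnj_complex_of_real)

lemma cinner_self: "cinner x x = complex_of_real ((norm x)\<^sup>2)"
proof -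
  have "Im (cinner x x) = 0"
    using cinner_commute[of x x] by (metis cnj.simps(2) equal_neg_zero)
  moreover have "Re (cinner x x) = (norm x)\<^sup>2"
    by (simp add: norm_eq_sqrt_cinner cinner_ge_zero)
  ultimately show ?thesis
    by (simp add: complex_eq_iff)
qed

lemma Re_cinner_self: "Re (cinner x x) = (norm x)\<^sup>2"
  by (simp only: cinner_self Re_complex_of_real)

lemma Re_cinner_commute: "Re (cinner x y) = Re (cinner y x)"
  by (metis cinner_commute cnj.simps(1))

lemma norm_add_square: "(norm (x + y))\<^sup>2 = (norm x)\<^sup>2 + 2 * Re (cinner x y) + (norm y)\<^sup>2"
  for x :: "'a::complex_inner"
  unfolding Re_cinner_self[symmetric]
  by (simp add: cinner_add_left cinner_add_right Re_cinner_commute[of y x])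

text \<open>The triangle inequality, squared and expanded, is exactly the Cauchy-Schwarz bound for
  real parts.\<close>

lemma Re_cinner_le: "Re (cinner x y) \<le> norm x * norm y"
proof -
  have "(norm (x + y))\<^sup>2 \<le> (norm x + norm y)\<^sup>2"
    by (simp add: norm_triangle_ineq power_mono)
  then show ?thesis
    by (simp add: norm_add_square power2_sum)
qed

lemma norm_scaleC: "norm (c *\<^sub>C x) = cmod c * norm x" for x :: "'a::complex_inner"
proof -
  have "(norm (c *\<^sub>C x))\<^sup>2 = Re ((c * cnj c) * cinner x x)"
    by (simp only: Re_cinner_self[symmetric] cinner_scaleC_left cinner_scaleC_right
        mult.left_commute mult.assoc)
  also have "\<dots> = (cmod c * norm x)\<^sup>2"
    by (simp add: cinner_self power_mult_distrib flip: complex_norm_square)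
  finally show ?thesis
    by simp
qed

lemma norm_cinner_le: "cmod (cinner x y) \<le> norm x * norm y"
proof (cases "cinner x y = 0")
  case False
  \<comment> \<open>A unimodular factor rotating \<open>cinner x y\<close> onto its modulus, so that
    the bound for real parts applies.\<close>
  define c where "c = cnj (cinner x y) / cmod (cinner x y)"
  have c: "cmod c = 1"
    using False by (simp add: c_def norm_divide)
  have "cmod (cinner x y) = Re (c * cinner x y)"
    using False
    by (simp add: c_def mult.commute[of "cnj _"] power2_eq_square flip: complex_norm_square)
  also have "\<dots> \<le> norm (c *\<^sub>C x) * norm y"
    using Re_cinner_le[of "c *\<^sub>C x" y] by (simp only: cinner_scaleC_left)
  finally show ?thesis
    using c by (simp add: norm_scaleC)
qed simp

interpretation cinner: bounded_bilinear "cinner :: 'a::complex_inner \<Rightarrow> 'a \<Rightarrow> complex"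
proof
  show "\<exists>K. \<forall>x y. norm (cinner (x::'a) y) \<le> norm x * norm y * K"
    using norm_cinner_le by (metis mult.right_neutral)
qed (simp_all add: cinner_add_left cinner_add_right cinner_scaleR_left cinner_scaleR_right)

lemma norm_diff_square: "(norm (x - y))\<^sup>2 = (norm x)\<^sup>2 - 2 * Re (cinner x y) + (norm y)\<^sup>2"
  for x :: "'a::complex_inner"
  using norm_add_square[of x "- y"] by (simp add: cinner.minus_right)

lemma parallelogram_law:
  "(norm (x + y))\<^sup>2 + (norm (x - y))\<^sup>2 = 2 * (norm x)\<^sup>2 + 2 * (norm y)\<^sup>2"
  for x :: "'a::complex_inner"
  by (simp add: norm_add_square norm_diff_square)

lemma cinner_eqI:
  assumes "\<And>z. cinner x z = cinner y z"
  shows "x = y"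
proof -
  have "cinner (x - y) (x - y) = 0"
    by (simp add: cinner.diff_left assms)
  then show ?thesis
    by (simp add: cinner_self)
qed

lemma cinner_eqI_right:
  assumes "\<And>z. cinner z x = cinner z y"
  shows "x = y"
  by (rule cinner_eqI) (simp only: cinner_commute[of x] cinner_commute[of y] assms)

lemma Re_cinner_eqI_right:
  assumes "\<And>z. Re (cinner z x) = Re (cinner z y)"
  shows "x = y"
proof -
  have "Re (cinner (x - y) (x - y)) = 0"
    using assms by (simp add: cinner.diff_right)
  then show ?thesis
    by (simp add: Re_cinner_self)
qed

lemma scaleC_zero_right [simp]: "c *\<^sub>C 0 = (0::'a::complex_vector)"
  by (metis add_cancel_right_right scaleC_add_right)

lemma scaleC_scaleR_commute: "c *\<^sub>C r *\<^sub>R x = r *\<^sub>R c *\<^sub>C x" for x :: "'a::complex_vector"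
  by (metis mult.commute scaleC_of_real scaleC_scaleC)

lemma scaleC_minus_right: "c *\<^sub>C (- x) = - (c *\<^sub>C x)" for x :: "'a::complex_vector"
  by (metis scaleC_scaleR_commute scaleR_minus1_left)

lemma scaleC_diff_right: "c *\<^sub>C (x - y) = c *\<^sub>C x - c *\<^sub>C y" for x :: "'a::complex_vector"
  by (metis diff_conv_add_uminus scaleC_add_right scaleC_minus_right)

lemma bounded_linear_scaleC: "bounded_linear (\<lambda>x::'a::complex_inner. c *\<^sub>C x)"
  by (rule bounded_linear_intro[where K="cmod c"])
    (simp_all add: scaleC_add_right scaleC_scaleR_commute norm_scaleC mult.commute)

section \<open>Bounded operators and adjoints\<close>

lemma bounded_clinear_imp_bounded_linear: "bounded_clinear T \<Longrightarrow> bounded_linear T"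
  unfolding bounded_clinear_def by (metis bounded_linear_intro scaleC_of_real)

lemma bounded_clinear_iff:
  "bounded_clinear T \<longleftrightarrow> bounded_linear T \<and> (\<forall>c x. T (c *\<^sub>C x) = c *\<^sub>C T x)"
proof
  assume "bounded_linear T \<and> (\<forall>c x. T (c *\<^sub>C x) = c *\<^sub>C T x)"
  then show "bounded_clinear T"
    unfolding bounded_clinear_def by (metis bounded_linear.bounded linear_add bounded_linear.linear)
qed (auto simp: bounded_clinear_imp_bounded_linear, simp add: bounded_clinear_def)

lemma bounded_clinear_compose:
  assumes "bounded_clinear S" "bounded_clinear T"
  shows "bounded_clinear (\<lambda>x. S (T x))"
  using assms by (simp add: bounded_clinear_iff bounded_linear_compose)

lemma bounded_clinear_diff:
  assumes "bounded_clinear S" "bounded_clinear T"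
  shows "bounded_clinear (\<lambda>x. S x - T x)"
  using assms by (simp add: bounded_clinear_iff bounded_linear_sub scaleC_diff_right)

lemma bounded_clinear_scaleR:
  assumes "bounded_clinear S"
  shows "bounded_clinear (\<lambda>x. r *\<^sub>R S x)"
  using assms
  by (simp add: bounded_clinear_iff bounded_linear_const_scaleR scaleC_scaleR_commute)

lemma bounded_clinear_ident: "bounded_clinear (\<lambda>x. x)"
  by (simp add: bounded_clinear_iff)

lemma bounded_clinear_funpow:
  fixes S :: "'a::complex_inner \<Rightarrow> 'a"
  assumes "bounded_clinear S"
  shows "bounded_clinear (S ^^ n)"
proof (induction n)
  case 0
  show ?case by (simp add: bounded_clinear_iff)
next
  case (Suc n)
  then show ?case using bounded_clinear_compose[OF assms Suc] by (simp add: o_def)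
qed

text \<open>Minimising \<open>\<parallel>T x\<parallel>\<^sup>2 - 2 f x\<close> yields at once the Riesz representation theorem
  (\<open>T = id\<close>) and the invertibility of \<open>T\<^sup>*T\<close> for expansive \<open>T\<close>.\<close>

lemma expansive_representation:
  fixes T :: "'a::chilbert_space \<Rightarrow> 'a" and f :: "'a \<Rightarrow> real"
  assumes T: "bounded_linear T" and expansive: "\<And>x. norm x \<le> norm (T x)" and f: "bounded_linear f"
  obtains x where "\<And>y. Re (cinner (T y) (T x)) = f y"
proof -
  interpret T: bounded_linear T by fact
  interpret f: bounded_linear f by fact
  define \<Phi> where "\<Phi> x = (norm (T x))\<^sup>2 - 2 * f x" for x
  obtain K where K: "\<And>x. norm (f x) \<le> norm x * K"
    using f.bounded by blast
  \<comment> \<open>Expansivity replaces \<open>norm (T x)\<close> by \<open>norm x\<close>;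
    completing the square then bounds \<open>\<Phi>\<close> from below.\<close>
  have lower: "- K\<^sup>2 \<le> \<Phi> x" for x
  proof -
    have "f x \<le> norm x * K"
      using K[of x] by simp
    moreover have "(norm x)\<^sup>2 \<le> (norm (T x))\<^sup>2"
      using expansive power_mono norm_ge_zero by blast
    moreover have "0 \<le> (norm x - K)\<^sup>2" by simp
    ultimately show ?thesis
      unfolding \<Phi>_def power2_diff by linarith
  qed
  define m where "m = (INF x. \<Phi> x)"
  have bdd: "bdd_below (range \<Phi>)"
    using lower by (meson bdd_belowI2)
  have m_le: "m \<le> \<Phi> x" for x
    unfolding m_def by (rule cINF_lower[OF bdd]) simp
  have "\<exists>x. \<Phi> x < m + inverse (real (Suc n))" for n
  proof -
    have "(INF x. \<Phi> x) < m + inverse (real (Suc n))"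
      unfolding m_def by (simp only: less_add_same_cancel1) simp
    then show ?thesis
      by (subst (asm) cINF_less_iff[OF _ bdd]) auto
  qed
  then obtain X where X: "\<And>n. \<Phi> (X n) < m + inverse (real (Suc n))"
    by metis
  \<comment> \<open>The parallelogram law for \<open>T x\<close> and \<open>T y\<close> brings in
    \<open>\<Phi>\<close> at the midpoint, which is at least \<open>m\<close>. Hence a minimising
    sequence is Cauchy.\<close>
  have dist: "(norm (x - y))\<^sup>2 \<le> 2 * (\<Phi> x - m) + 2 * (\<Phi> y - m)" for x y
  proof -
    have "(norm (x - y))\<^sup>2 \<le> (norm (T x - T y))\<^sup>2"
      using expansive[of "x - y"] by (simp add: power_mono T.diff)
    also have "\<dots> = 2 * (norm (T x))\<^sup>2 + 2 * (norm (T y))\<^sup>2 - (norm (T x + T y))\<^sup>2"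
      using parallelogram_law[of "T x" "T y"] by simp
    also have "\<dots> = 2 * \<Phi> x + 2 * \<Phi> y - 4 * \<Phi> ((1/2) *\<^sub>R (x + y))"
      unfolding \<Phi>_def
      by (simp add: T.add T.scaleR f.add f.scaleR power_mult_distrib power2_eq_square algebra_simps
          flip: scaleR_add_right)
    also have "\<dots> \<le> 2 * (\<Phi> x - m) + 2 * (\<Phi> y - m)"
      using m_le[of "(1/2) *\<^sub>R (x + y)"] by (simp add: algebra_simps)
    finally show ?thesis .
  qed
  have "Cauchy X"
  proof (rule CauchyI)
    fix e :: real
    assume e: "0 < e"
    then obtain N where N: "inverse (real (Suc N)) < e\<^sup>2 / 4"
      using reals_Archimedean[of "e\<^sup>2 / 4"] by auto
    have small: "\<Phi> (X n) - m < e\<^sup>2 / 4" if "n \<ge> N" for n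
    proof -
      have "inverse (real (Suc n)) \<le> inverse (real (Suc N))"
        using that by (intro le_imp_inverse_le) auto
      then show ?thesis
        using X[of n] N by linarith
    qed
    have "norm (X i - X j) < e" if "i \<ge> N" "j \<ge> N" for i j
    proof -
      have "(norm (X i - X j))\<^sup>2 < e\<^sup>2"
        using dist[of "X i" "X j"] add_strict_mono[OF small[OF that(1)] small[OF that(2)]] by simp
      then show ?thesis
        using e by (simp add: power2_less_imp_less)
    qed
    then show "\<exists>M. \<forall>i\<ge>M. \<forall>j\<ge>M. norm (X i - X j) < e" by blast
  qed
  then obtain x where x: "X \<longlonglongrightarrow> x"
    by (metis Cauchy_convergent convergent_def)
  have "(\<lambda>n. \<Phi> (X n)) \<longlonglongrightarrow> \<Phi> x"
    unfolding \<Phi>_def using x by (intro tendsto_intros T.tendsto f.tendsto)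
  moreover have "(\<lambda>n. m + inverse (real (Suc n))) \<longlonglongrightarrow> m"
    using tendsto_add[OF tendsto_const LIMSEQ_inverse_real_of_nat] by simp
  ultimately have min: "\<Phi> x \<le> m"
    by (rule LIMSEQ_le) (use X less_imp_le in blast)
  have "Re (cinner (T y) (T x)) = f y" for y
  proof -
    \<comment> \<open>First variation: \<open>t * b + t\<^sup>2 * a\<close> is the increment of
      \<open>\<Phi>\<close> from the minimiser \<open>x\<close> to \<open>x + t y\<close>. Being
      nonnegative for all real \<open>t\<close>, it forces \<open>b = 0\<close>.\<close>
    define b where "b = 2 * (Re (cinner (T y) (T x)) - f y)"
    define a where "a = (norm (T y))\<^sup>2"
    have quad: "0 \<le> t * b + t\<^sup>2 * a" for t
    proof -
      have "\<Phi> x \<le> \<Phi> (x + t *\<^sub>R y)"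
        using min m_le order_trans by blast
      also have "\<Phi> (x + t *\<^sub>R y) = \<Phi> x + (t * b + t\<^sup>2 * a)"
        unfolding \<Phi>_def a_def b_def
        by (simp add: T.add T.scaleR f.add f.scaleR norm_add_square cinner_scaleR_right
            Re_cinner_commute[of "T x"] algebra_simps power_mult_distrib)
      finally show ?thesis by simp
    qed
    have "a \<ge> 0" by (simp add: a_def)
    have "b = 0"
    proof (rule ccontr)
      assume "b \<noteq> 0"
      \<comment> \<open>The test value is \<open>t = - b / (a + 1)\<close>; the summand 1 keeps it
        meaningful when \<open>T y = 0\<close>.\<close>
      define u where "u = inverse (a + 1)"
      have u: "u > 0" "u * a = 1 - u"
        using \<open>a \<ge> 0\<close> by (simp_all add: u_def field_simps)
      have "0 \<le> (- (b * u)) * b + (- (b * u))\<^sup>2 * a"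
        by (rule quad)
      also have "\<dots> = - (b\<^sup>2 * u) + b\<^sup>2 * u * (u * a)"
        by (simp add: power2_eq_square)
      also have "\<dots> = - (b * u)\<^sup>2"
        unfolding u(2) by (simp add: power2_eq_square algebra_simps)
      also have "\<dots> < 0"
        using u(1) \<open>b \<noteq> 0\<close> by simp
      finally show False by simp
    qed
    then show ?thesis by (simp add: b_def)
  qed
  then show thesis using that by blast
qed

text \<open>A relational form of the adjoint: it composes freely without any question of existence,
  and \<open>adj_eqI\<close> converts a witness into the value of \<open>adj\<close>.\<close>

definition is_adjoint :: "('a::complex_inner \<Rightarrow> 'a) \<Rightarrow> ('a \<Rightarrow> 'a) \<Rightarrow> bool" where
  "is_adjoint T S \<longleftrightarrow> (\<forall>x y. cinner (T x) y = cinner x (S y))"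

lemma is_adjointD: "is_adjoint T S \<Longrightarrow> cinner (T x) y = cinner x (S y)"
  by (simp add: is_adjoint_def)

lemma is_adjoint_sym: "is_adjoint T S \<Longrightarrow> is_adjoint S T"
  unfolding is_adjoint_def by (subst (1 2) cinner_commute) simp

lemma is_adjoint_unique: "is_adjoint T S \<Longrightarrow> is_adjoint T R \<Longrightarrow> S = R"
  unfolding is_adjoint_def by (metis cinner_eqI_right ext)

lemma is_adjoint_compose:
  "is_adjoint T S \<Longrightarrow> is_adjoint T' S' \<Longrightarrow> is_adjoint (\<lambda>x. T (T' x)) (\<lambda>x. S' (S x))"
  by (simp add: is_adjoint_def)

lemma is_adjoint_diff:
  "is_adjoint T S \<Longrightarrow> is_adjoint T' S' \<Longrightarrow> is_adjoint (\<lambda>x. T x - T' x) (\<lambda>x. S x - S' x)"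
  by (simp add: is_adjoint_def cinner.diff_left cinner.diff_right)

lemma is_adjoint_scaleR:
  "is_adjoint T S \<Longrightarrow> is_adjoint (\<lambda>x. r *\<^sub>R T x) (\<lambda>x. r *\<^sub>R S x)"
  by (simp add: is_adjoint_def cinner_scaleR_left cinner_scaleR_right)

lemma is_adjoint_ident: "is_adjoint (\<lambda>x. x) (\<lambda>x. x)"
  by (simp add: is_adjoint_def)

lemma is_adjoint_funpow:
  assumes "is_adjoint T S"
  shows "is_adjoint (T ^^ n) (S ^^ n)"
proof (induction n)
  case 0
  then show ?case by (simp add: is_adjoint_def)
next
  case (Suc n)
  then show ?case
    using assms unfolding is_adjoint_def by (simp add: funpow_swap1)
qed

lemma adj_eqI:
  assumes "is_adjoint T S"
  shows "adj T = S"
  unfolding adj_def is_adjoint_def[symmetric]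
  by (rule some_equality) (use assms is_adjoint_unique in blast)+

text \<open>Testing at \<open>\<i> *\<^sub>C x\<close> turns imaginary parts into real ones, up to
  sign.\<close>

lemma Re_cinner_imp_cinner:
  assumes "\<And>c x. S (c *\<^sub>C x) = c *\<^sub>C S x" and "\<And>x. Re (cinner (S x) y) = Re (cinner x z)"
  shows "cinner (S x) y = cinner x z"
proof (rule complex_eqI)
  have "Re (cinner (S (\<i> *\<^sub>C x)) y) = Re (cinner (\<i> *\<^sub>C x) z)"
    by (rule assms(2))
  then show "Im (cinner (S x) y) = Im (cinner x z)"
    by (simp add: assms(1) cinner_scaleC_left)
qed (rule assms)

text \<open>For fixed \<open>y\<close> the Riesz theorem represents the real functional
  \<open>Re (cinner (T x) y)\<close>; complex linearity of \<open>T\<close> upgrades this to the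
  full inner product.\<close>

lemma is_adjoint_adj:
  fixes T :: "'a::chilbert_space \<Rightarrow> 'a"
  assumes "bounded_clinear T"
  shows "is_adjoint T (adj T)"
proof -
  have T: "bounded_linear T" and TC: "\<And>c x. T (c *\<^sub>C x) = c *\<^sub>C T x"
    using assms by (auto simp: bounded_clinear_iff)
  have "\<exists>z. \<forall>x. cinner (T x) y = cinner x z" for y
  proof -
    have "bounded_linear (\<lambda>x. Re (cinner (T x) y))"
      using bounded_linear_compose[OF bounded_linear_Re
          bounded_linear_compose[OF cinner.bounded_linear_left T]] .
    then obtain z where "\<And>x. Re (cinner x z) = Re (cinner (T x) y)"
      using expansive_representation[OF bounded_linear_ident order_refl] by blast
    then show ?thesis
      using Re_cinner_imp_cinner[OF TC] by metis
  qed
  then obtain S where "is_adjoint T S"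
    unfolding is_adjoint_def by metis
  then show ?thesis
    using adj_eqI by blast
qed

lemma bounded_clinear_adjoint:
  assumes "is_adjoint T S" "bounded_clinear T"
  shows "bounded_clinear S"
proof -
  have adj: "cinner z (S x) = cinner (T z) x" for x z
    using assms(1) by (simp add: is_adjoint_def)
  obtain K where K: "\<And>x. norm (T x) \<le> norm x * K" "K \<ge> 0"
    using bounded_linear.nonneg_bounded[OF bounded_clinear_imp_bounded_linear[OF assms(2)]] by blast
  have "norm (S x) \<le> norm x * K" for x
  proof (cases "S x = 0")
    case False
    have "(norm (S x))\<^sup>2 = Re (cinner (T (S x)) x)"
      by (simp only: Re_cinner_self[symmetric] adj)
    also have "\<dots> \<le> (norm (S x) * K) * norm x"
      using Re_cinner_le[of "T (S x)" x] mult_right_mono[OF K(1)[of "S x"], of "norm x"] by simp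
    finally show ?thesis
      using False by (simp add: power2_eq_square mult.assoc mult.commute[of K])
  qed (simp add: K)
  moreover have "S (x + y) = S x + S y" for x y
    by (rule cinner_eqI_right) (simp add: adj cinner_add_right)
  moreover have "S (c *\<^sub>C x) = c *\<^sub>C S x" for c x
    by (rule cinner_eqI_right) (simp add: adj cinner_scaleC_right)
  ultimately show ?thesis
    unfolding bounded_clinear_def by blast
qed

section \<open>Positive contractions and their square roots\<close>

text \<open>This is the form inequality \<open>0 <= X <= I\<close>; the bound on the operator norm
  is derived from it below.\<close>

definition positive_contraction :: "('a::complex_inner \<Rightarrow> 'a) \<Rightarrow> bool" where
  "positive_contraction X \<longleftrightarrow> bounded_clinear X \<and> is_adjoint X X \<and>
     (\<forall>x. 0 \<le> Re (cinner (X x) x) \<and> Re (cinner (X x) x) \<le> (norm x)\<^sup>2)"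

lemma
  assumes "positive_contraction X"
  shows positive_contraction_bounded_clinear: "bounded_clinear X"
    and positive_contraction_bounded_linear: "bounded_linear X"
    and positive_contraction_adjoint: "is_adjoint X X"
    and positive_contraction_nonneg: "0 \<le> Re (cinner (X x) x)"
    and positive_contraction_upper: "Re (cinner (X x) x) \<le> (norm x)\<^sup>2"
  using assms by (auto simp: positive_contraction_def bounded_clinear_imp_bounded_linear)

lemma positive_contraction_complement:
  assumes "positive_contraction X"
  shows "positive_contraction (\<lambda>x. x - X x)"
  using assms unfolding positive_contraction_def
  by (simp add: bounded_clinear_diff bounded_clinear_ident is_adjoint_diff is_adjoint_ident
      cinner.diff_left Re_cinner_self)

text \<open>This is \<open>X\<^sup>2 \<le> X\<close>, read off from \<open>X - X\<^sup>2 = X (I - X) X + (I - X) X (I - X)\<close>.\<close>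

lemma positive_contraction_norm_square_le:
  assumes X: "positive_contraction X"
  shows "(norm (X x))\<^sup>2 \<le> Re (cinner (X x) x)"
proof -
  interpret X: bounded_linear X
    using X by (rule positive_contraction_bounded_linear)
  have adj: "cinner (X y) z = cinner y (X z)" for y z
    using is_adjointD[OF positive_contraction_adjoint[OF X]] .
  have "0 \<le> Re (cinner (X x - X (X x)) (X x))"
    by (rule positive_contraction_nonneg[OF positive_contraction_complement[OF X]])
  moreover have "0 \<le> Re (cinner (X (x - X x)) (x - X x))"
    by (rule positive_contraction_nonneg[OF X])
  moreover have "(norm (X x))\<^sup>2 = Re (cinner x (X (X x)))"
    by (simp only: Re_cinner_self[symmetric] adj)
  ultimately show ?thesis
    by (simp add: X.diff cinner.diff_left cinner.diff_right adj)
qed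

lemma positive_contraction_norm_le:
  assumes "positive_contraction X"
  shows "norm (X x) \<le> norm x"
  using order_trans[OF positive_contraction_norm_square_le[OF assms]
      positive_contraction_upper[OF assms]]
  by (simp add: power2_le_iff_abs_le)

lemma positive_contraction_eq_zero:
  assumes "positive_contraction X" "Re (cinner (X x) x) = 0"
  shows "X x = 0"
  using positive_contraction_norm_square_le[OF assms(1), of x] assms(2) by simp

lemma positive_contraction_funpow_norm_le:
  assumes "positive_contraction X"
  shows "norm ((X ^^ n) x) \<le> norm x"
  by (induction n) (auto intro: order_trans[OF positive_contraction_norm_le[OF assms]])

text \<open>The coefficients of \<open>1 - sqrt (1 - y) = (\<Sum>k. sqrt_coeff k * y ^ Suc k)\<close>; the recursion
  expresses that \<open>q = 1 - sqrt (1 - y)\<close> solves \<open>q = (y + q\<^sup>2) / 2\<close>.\<close>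

fun sqrt_coeff :: "nat \<Rightarrow> real" where
  "sqrt_coeff 0 = 1 / 2"
| "sqrt_coeff (Suc n) = (\<Sum>i\<le>n. sqrt_coeff i * sqrt_coeff (n - i)) / 2"

lemma sqrt_coeff_nonneg: "0 \<le> sqrt_coeff n"
proof (induction n rule: less_induct)
  case (less n)
  then show ?case
    by (cases n) (auto intro!: sum_nonneg mult_nonneg_nonneg)
qed

text \<open>By the recursion the next partial sum is 1/2 plus half of a triangular part of the
  square of the current one, hence at most 1/2 + 1/2.\<close>

lemma sum_sqrt_coeff_le: "(\<Sum>k<N. sqrt_coeff k) \<le> 1"
proof (induction N)
  case (Suc N)
  let ?c = sqrt_coeff
  have "(\<Sum>n<N. \<Sum>i\<le>n. ?c i * ?c (n - i)) = (\<Sum>(i, j)\<in>{(i, j). i + j < N}. ?c i * ?c j)"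
    by (rule sum.triangle_reindex[symmetric])
  also have "\<dots> \<le> (\<Sum>(i, j)\<in>{..<N} \<times> {..<N}. ?c i * ?c j)"
    by (intro sum_mono2) (auto intro: mult_nonneg_nonneg sqrt_coeff_nonneg)
  also have "\<dots> = (\<Sum>k<N. ?c k) * (\<Sum>k<N. ?c k)"
    by (simp add: sum_product sum.cartesian_product)
  finally have "(\<Sum>n<N. \<Sum>i\<le>n. ?c i * ?c (n - i)) \<le> (\<Sum>k<N. ?c k) * (\<Sum>k<N. ?c k)" .
  also have "\<dots> \<le> 1"
    using Suc.IH by (intro mult_le_one) (auto intro: sum_nonneg sqrt_coeff_nonneg)
  finally have "(\<Sum>n<N. \<Sum>i\<le>n. ?c i * ?c (n - i)) \<le> 1" .
  moreover have "(\<Sum>k<Suc N. ?c k) = 1 / 2 + (\<Sum>n<N. \<Sum>i\<le>n. ?c i * ?c (n - i)) / 2"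
    by (simp add: sum.lessThan_Suc_shift sum_divide_distrib del: sum.lessThan_Suc)
  ultimately show ?case
    by simp
qed simp

lemma summable_sqrt_coeff: "summable sqrt_coeff"
  by (rule bounded_imp_summable[OF sqrt_coeff_nonneg, where B=1])
    (metis sum_sqrt_coeff_le lessThan_Suc_atMost)

lemma suminf_sqrt_coeff_le: "(\<Sum>k. sqrt_coeff k) \<le> 1"
  by (rule suminf_le_const[OF summable_sqrt_coeff sum_sqrt_coeff_le])

lemma summable_scaleR_bounded:
  fixes h :: "nat \<Rightarrow> 'a::banach"
  assumes c: "summable c" "\<And>k. 0 \<le> c k" and h: "\<And>k. norm (h k) \<le> K"
  shows "summable (\<lambda>k. norm (c k *\<^sub>R h k))" "summable (\<lambda>k. c k *\<^sub>R h k)"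
    "norm (\<Sum>k. c k *\<^sub>R h k) \<le> (\<Sum>k. c k) * K"
proof -
  have le: "norm (c k *\<^sub>R h k) \<le> c k * K" for k
    using c(2)[of k] h[of k] by (simp add: mult_left_mono)
  have sum: "summable (\<lambda>k. c k * K)"
    using c(1) by (rule summable_mult2)
  show *: "summable (\<lambda>k. norm (c k *\<^sub>R h k))"
    by (rule summable_comparison_test'[OF sum]) (use le in simp)
  show "summable (\<lambda>k. c k *\<^sub>R h k)"
    by (rule summable_norm_cancel[OF *])
  have "norm (\<Sum>k. c k *\<^sub>R h k) \<le> (\<Sum>k. norm (c k *\<^sub>R h k))"
    by (rule summable_norm[OF *])
  also have "\<dots> \<le> (\<Sum>k. c k * K)"
    by (rule suminf_le[OF le * sum])
  finally show "norm (\<Sum>k. c k *\<^sub>R h k) \<le> (\<Sum>k. c k) * K"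
    by (simp add: suminf_mult2[OF c(1)])
qed

lemma suminf_eq_infsum: "f summable_on UNIV \<Longrightarrow> suminf f = infsum f UNIV"
  for f :: "nat \<Rightarrow> 'a::{topological_comm_monoid_add,t2_space}"
  by (metis has_sum_imp_sums has_sum_infsum sums_unique)

text \<open>Absolute summability over the grid of pairs permits regrouping along the antidiagonals
  \<open>i + j = n\<close>. This is what squares the series in \<open>sqrt_op\<close>.\<close>

lemma suminf_Cauchy_product_scaleR:
  fixes h :: "nat \<Rightarrow> 'a::banach"
  assumes c: "summable c" "\<And>k. 0 \<le> c k" and h: "\<And>k. norm (h k) \<le> K"
  shows "(\<Sum>i. c i *\<^sub>R (\<Sum>j. c j *\<^sub>R h (i + j))) = (\<Sum>n. (\<Sum>i\<le>n. c i * c (n - i)) *\<^sub>R h n)"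
proof -
  define g where "g = (\<lambda>(i, j). (c i * c j) *\<^sub>R h (i + j))"
  have c_on: "c summable_on UNIV"
    using norm_summable_imp_summable_on[of c] c by simp
  have K: "0 \<le> K"
    using h[of 0] norm_ge_zero order_trans by blast
  have "(\<lambda>p. norm (c (fst p) * c (snd p))) summable_on (UNIV \<times> UNIV)"
    by (subst Infinite_Sum.abs_summable_on_Sigma_iff)
      (simp add: c abs_mult infsum_cmult_right' infsum_nonneg summable_on_cmult_right
        summable_on_cmult_left c_on)
  then have "(\<lambda>p. norm (c (fst p) * c (snd p)) * K) summable_on (UNIV \<times> UNIV)"
    by (rule summable_on_cmult_left)
  then have g_abs: "(\<lambda>p. norm (g p)) summable_on (UNIV \<times> UNIV)"
    by (rule Infinite_Sum.abs_summable_on_comparison_test'[where f=g])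
      (auto simp: g_def c abs_mult mult_left_mono h)
  then have g_on: "g summable_on (UNIV \<times> UNIV)"
    by (rule abs_summable_summable)
  have inner: "(\<Sum>\<^sub>\<infinity>j. g (i, j)) = c i *\<^sub>R (\<Sum>j. c j *\<^sub>R h (i + j))" for i
  proof -
    have "(\<lambda>j. c j *\<^sub>R h (i + j)) summable_on UNIV"
      by (rule norm_summable_imp_summable_on) (rule summable_scaleR_bounded[OF c h])
    then show ?thesis
      unfolding g_def by (simp add: infsum_scaleR_right suminf_eq_infsum flip: scaleR_scaleR)
  qed
  have outer: "(\<lambda>i. \<Sum>\<^sub>\<infinity>j. g (i, j)) summable_on UNIV"
    using summable_on_Sigma_banach[of "\<lambda>i j. g (i, j)" UNIV "\<lambda>_. UNIV"] g_on by (simp add: case_prod_unfold)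
  have "(\<Sum>i. c i *\<^sub>R (\<Sum>j. c j *\<^sub>R h (i + j))) = (\<Sum>\<^sub>\<infinity>i. \<Sum>\<^sub>\<infinity>j. g (i, j))"
    unfolding inner[symmetric] by (rule suminf_eq_infsum[OF outer])
  also have "\<dots> = infsum g (UNIV \<times> UNIV)"
    by (rule infsum_Sigma_banach[OF g_on])
  finally have lhs: "(\<Sum>i. c i *\<^sub>R (\<Sum>j. c j *\<^sub>R h (i + j))) = infsum g (UNIV \<times> UNIV)" .
  define \<phi> :: "nat \<times> nat \<Rightarrow> nat \<times> nat" where "\<phi> = (\<lambda>(n, i). (i, n - i))"
  have bij: "bij_betw \<phi> (SIGMA n:UNIV. {..n}) (UNIV \<times> UNIV)"
    by (rule bij_betw_byWitness[where f'="\<lambda>(i, j). (i + j, i)"]) (auto simp: \<phi>_def)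
  have gphi_on: "(\<lambda>p. g (\<phi> p)) summable_on (SIGMA n:UNIV. {..n})"
    using g_on summable_on_reindex_bij_betw[OF bij, of g] by simp
  have row: "(\<Sum>\<^sub>\<infinity>i\<in>{..n}. g (\<phi> (n, i))) = (\<Sum>i\<le>n. c i * c (n - i)) *\<^sub>R h n" for n
    by (simp add: \<phi>_def g_def scaleR_sum_left)
  have "infsum g (UNIV \<times> UNIV) = infsum (\<lambda>p. g (\<phi> p)) (SIGMA n:UNIV. {..n})"
    by (rule infsum_reindex_bij_betw[OF bij, symmetric])
  also have "\<dots> = (\<Sum>\<^sub>\<infinity>n. \<Sum>\<^sub>\<infinity>i\<in>{..n}. g (\<phi> (n, i)))"
    by (rule infsum_Sigma_banach[OF gphi_on, symmetric])
  also have "\<dots> = (\<Sum>n. (\<Sum>i\<le>n. c i * c (n - i)) *\<^sub>R h n)"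
    using summable_on_Sigma_banach[of "\<lambda>n i. g (\<phi> (n, i))" UNIV atMost] gphi_on
    unfolding row by (intro suminf_eq_infsum[symmetric]) (simp add: case_prod_unfold)
  finally show ?thesis
    using lhs by simp
qed

text \<open>The binomial series of \<open>sqrt (1 - y)\<close> at \<open>y = I - X\<close>;
  coefficient \<open>k\<close> belongs to the power \<open>k + 1\<close>, the constant term being
  split off.\<close>

definition sqrt_op :: "('a::chilbert_space \<Rightarrow> 'a) \<Rightarrow> 'a \<Rightarrow> 'a" where
  "sqrt_op X x = x - (\<Sum>k. sqrt_coeff k *\<^sub>R ((\<lambda>y. y - X y) ^^ Suc k) x)"

lemma funpow_intertwine:
  assumes "\<And>x. G (X x) = Y (G x)"
  shows "G ((X ^^ n) x) = (Y ^^ n) (G x)"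
  by (induction n) (simp_all add: assms)

context
  fixes X :: "'a::chilbert_space \<Rightarrow> 'a"
  assumes X: "positive_contraction X"
begin

lemma summable_sqrt_op: "summable (\<lambda>k. sqrt_coeff k *\<^sub>R ((\<lambda>y. y - X y) ^^ Suc k) x)"
  and norm_suminf_sqrt_op_le:
    "norm (\<Sum>k. sqrt_coeff k *\<^sub>R ((\<lambda>y. y - X y) ^^ Suc k) x) \<le> norm x"
proof -
  note bound = summable_scaleR_bounded[OF summable_sqrt_coeff sqrt_coeff_nonneg
      positive_contraction_funpow_norm_le[OF positive_contraction_complement[OF X]]]
  show "summable (\<lambda>k. sqrt_coeff k *\<^sub>R ((\<lambda>y. y - X y) ^^ Suc k) x)"
    by (rule bound(2))
  have "(\<Sum>k. sqrt_coeff k) * norm x \<le> norm x"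
    using mult_right_mono[OF suminf_sqrt_coeff_le, of "norm x"] by simp
  then show "norm (\<Sum>k. sqrt_coeff k *\<^sub>R ((\<lambda>y. y - X y) ^^ Suc k) x) \<le> norm x"
    by (rule order_trans[OF bound(3)])
qed

text \<open>Continuity carries \<open>G\<close> through the series term by term. With
  \<open>Y = X\<close> this is commutation with the root; with \<open>Y\<close> different from
  \<open>X\<close> it transports roots along \<open>T\<close>.\<close>

lemma sqrt_op_intertwine:
  assumes G: "bounded_linear G" and GX: "\<And>x. G (X x) = Y (G x)"
  shows "G (sqrt_op X x) = sqrt_op Y (G x)"
proof -
  interpret G: bounded_linear G by fact
  have "G (((\<lambda>y. y - X y) ^^ Suc k) x) = ((\<lambda>y. y - Y y) ^^ Suc k) (G x)" for k
    by (rule funpow_intertwine) (simp add: G.diff GX)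
  then show ?thesis
    unfolding sqrt_op_def by (simp only: G.diff G.suminf[OF summable_sqrt_op] G.scaleR)
qed

lemma bounded_clinear_sqrt_op: "bounded_clinear (sqrt_op X)"
proof -
  let ?Y = "\<lambda>y. y - X y"
  have Y: "bounded_clinear (?Y ^^ n)" for n
    by (rule bounded_clinear_funpow)
      (rule positive_contraction_bounded_clinear[OF positive_contraction_complement[OF X]])
  have lin: "(?Y ^^ n) (x + y) = (?Y ^^ n) x + (?Y ^^ n) y"
    "(?Y ^^ n) (a *\<^sub>C x) = a *\<^sub>C (?Y ^^ n) x" for n x y a
    using Y[of n] unfolding bounded_clinear_def by blast+
  show ?thesis
    unfolding bounded_clinear_def
  proof (intro conjI allI exI)
    show "norm (sqrt_op X x) \<le> norm x * 2" for x
      unfolding sqrt_op_def using norm_triangle_ineq4 norm_suminf_sqrt_op_le[of x]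
      by (smt (verit))
    show "sqrt_op X (x + y) = sqrt_op X x + sqrt_op X y" for x y
      unfolding sqrt_op_def lin scaleR_add_right
      by (subst suminf_add[symmetric, OF summable_sqrt_op summable_sqrt_op]) simp
    show "sqrt_op X (a *\<^sub>C x) = a *\<^sub>C sqrt_op X x" for a x
      unfolding sqrt_op_def lin
      by (simp only: scaleC_diff_right
          bounded_linear.suminf[OF bounded_linear_scaleC summable_sqrt_op]
          scaleC_scaleR_commute)
  qed
qed

lemma sqrt_op_adjoint: "is_adjoint (sqrt_op X) (sqrt_op X)"
  unfolding is_adjoint_def
proof (intro allI)
  fix x y :: 'a
  let ?Y = "\<lambda>y. y - X y"
  have Y: "cinner ((?Y ^^ n) x) y = cinner x ((?Y ^^ n) y)" for n
    by (rule is_adjointD[OF is_adjoint_funpow])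
      (rule positive_contraction_adjoint[OF positive_contraction_complement[OF X]])
  show "cinner (sqrt_op X x) y = cinner x (sqrt_op X y)"
    unfolding sqrt_op_def
    by (simp only: cinner.diff_left cinner.diff_right
        bounded_linear.suminf[OF cinner.bounded_linear_left summable_sqrt_op]
        bounded_linear.suminf[OF cinner.bounded_linear_right summable_sqrt_op]
        cinner_scaleR_left cinner_scaleR_right Y)
qed

text \<open>For the series \<open>Q\<close> in \<open>Y = I - X\<close>, the Cauchy product and the
  recursion of the coefficients give \<open>Q\<^sup>2 = 2 Q - Y\<close>, that is
  \<open>(I - Q)\<^sup>2 = I - Y = X\<close>.\<close>

lemma sqrt_op_square: "sqrt_op X (sqrt_op X x) = X x"
proof -
  define Y where "Y = (\<lambda>y. y - X y)"
  let ?c = sqrt_coeff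
  define Q where "Q z = (\<Sum>k. ?c k *\<^sub>R (Y ^^ Suc k) z)" for z
  have Y: "positive_contraction Y"
    unfolding Y_def by (rule positive_contraction_complement[OF X])
  have S: "sqrt_op X z = z - Q z" for z
    by (simp only: sqrt_op_def Q_def Y_def)
  have summ: "summable (\<lambda>k. ?c k *\<^sub>R (Y ^^ Suc k) z)" for z
    unfolding Y_def by (rule summable_sqrt_op)
  have bounded: "norm ((Y ^^ (n + 2)) x) \<le> norm x" for n
    by (rule positive_contraction_funpow_norm_le[OF Y])
  \<comment> \<open>Both series start at the first power, so terms \<open>i\<close> and
    \<open>j\<close> multiply to exponent \<open>i + j + 2\<close>.\<close>
  have Ypow: "(Y ^^ Suc i) (Q x) = (\<Sum>j. ?c j *\<^sub>R (Y ^^ (i + j + 2)) x)" for i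
  proof -
    interpret Yi: bounded_linear "Y ^^ Suc i"
      by (rule bounded_clinear_imp_bounded_linear[OF bounded_clinear_funpow
            [OF positive_contraction_bounded_clinear[OF Y]]])
    have "(Y ^^ Suc i) ((Y ^^ Suc j) x) = (Y ^^ (i + j + 2)) x" for j
    proof -
      have "i + j + 2 = Suc i + Suc j" by simp
      then show ?thesis by (simp only: funpow_add o_def)
    qed
    then show ?thesis
      unfolding Q_def by (simp only: Yi.suminf[OF summ] Yi.scaleR)
  qed
  have "Q (Q x) = (\<Sum>i. ?c i *\<^sub>R (\<Sum>j. ?c j *\<^sub>R (Y ^^ (i + j + 2)) x))"
    unfolding Q_def[of "Q x"] Ypow ..
  also have "\<dots> = (\<Sum>n. (\<Sum>i\<le>n. ?c i * ?c (n - i)) *\<^sub>R (Y ^^ (n + 2)) x)"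
    by (rule suminf_Cauchy_product_scaleR[OF summable_sqrt_coeff sqrt_coeff_nonneg bounded])
  also have "\<dots> = (\<Sum>n. 2 *\<^sub>R (?c (Suc n) *\<^sub>R (Y ^^ Suc (Suc n)) x))"
    by simp
  also have "\<dots> = 2 *\<^sub>R (\<Sum>n. ?c (Suc n) *\<^sub>R (Y ^^ Suc (Suc n)) x)"
    using summ[of x] by (intro suminf_scaleR_right[symmetric]) (subst (asm) summable_Suc_iff[symmetric])
  also have "\<dots> = 2 *\<^sub>R (Q x - (1 / 2) *\<^sub>R Y x)"
    unfolding Q_def using suminf_split_head[OF summ[of x]] by simp
  finally have QQ: "Q (Q x) = 2 *\<^sub>R Q x - Y x"
    by (simp add: scaleR_diff_right)
  have "sqrt_op X (sqrt_op X x) = sqrt_op X (x - Q x)"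
    by (simp only: S[of x])
  also have "\<dots> = sqrt_op X x - sqrt_op X (Q x)"
    using linear_diff bounded_linear.linear bounded_clinear_imp_bounded_linear
      bounded_clinear_sqrt_op by blast
  also have "\<dots> = x - Y x"
    by (simp add: S QQ scaleR_2)
  finally show ?thesis
    by (simp add: Y_def)
qed

lemma norm_sqrt_op_square: "(norm (sqrt_op X x))\<^sup>2 = Re (cinner (X x) x)"
  by (simp only: Re_cinner_self[symmetric] is_adjointD[OF sqrt_op_adjoint, symmetric] sqrt_op_square)

text \<open>Nonnegativity holds because the subtracted series has norm at most
  \<open>norm x\<close>; the upper bound comes from \<open>norm_sqrt_op_square\<close>.\<close>

lemma positive_contraction_sqrt_op: "positive_contraction (sqrt_op X)"
  unfolding positive_contraction_def
proof (intro conjI allI bounded_clinear_sqrt_op sqrt_op_adjoint)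
  fix x
  show "0 \<le> Re (cinner (sqrt_op X x) x)"
  proof -
    let ?q = "\<Sum>k. sqrt_coeff k *\<^sub>R ((\<lambda>y. y - X y) ^^ Suc k) x"
    have "Re (cinner ?q x) \<le> norm ?q * norm x"
      by (rule Re_cinner_le)
    also have "\<dots> \<le> (norm x)\<^sup>2"
      using norm_suminf_sqrt_op_le[of x] by (simp add: power2_eq_square mult_right_mono)
    finally show ?thesis
      unfolding sqrt_op_def by (simp add: cinner.diff_left Re_cinner_self)
  qed
  have "(norm (sqrt_op X x))\<^sup>2 \<le> (norm x)\<^sup>2"
    unfolding norm_sqrt_op_square by (rule positive_contraction_upper[OF X])
  then have "norm (sqrt_op X x) * norm x \<le> norm x * norm x"
    by (intro mult_right_mono) auto
  then show "Re (cinner (sqrt_op X x) x) \<le> (norm x)\<^sup>2"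
    using Re_cinner_le[of "sqrt_op X x" x] by (simp add: power2_eq_square)
qed

end

text \<open>With \<open>S = sqrt_op X\<close>, which commutes with \<open>Y\<close>, the product is
  \<open>S Y S\<close>, whose quadratic form is that of \<open>Y\<close> at
  \<open>S x\<close>.\<close>

lemma positive_contraction_compose:
  fixes X Y :: "'a::chilbert_space \<Rightarrow> 'a"
  assumes X: "positive_contraction X" and Y: "positive_contraction Y"
    and comm: "\<And>x. X (Y x) = Y (X x)"
  shows "positive_contraction (\<lambda>x. X (Y x))"
  unfolding positive_contraction_def
proof (intro conjI allI)
  show "bounded_clinear (\<lambda>x. X (Y x))"
    using X Y by (simp add: bounded_clinear_compose positive_contraction_bounded_clinear)
  show "is_adjoint (\<lambda>x. X (Y x)) (\<lambda>x. X (Y x))"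
    using is_adjoint_compose[OF X[THEN positive_contraction_adjoint] Y[THEN positive_contraction_adjoint]]
    by (simp add: comm)
  fix x
  let ?S = "sqrt_op X"
  have "X (Y x) = ?S (Y (?S x))"
    using sqrt_op_intertwine[OF X positive_contraction_bounded_linear[OF Y], of X x] comm
    by (metis sqrt_op_square[OF X])
  then have eq: "cinner (X (Y x)) x = cinner (Y (?S x)) (?S x)"
    by (simp add: is_adjointD[OF sqrt_op_adjoint[OF X]])
  show "0 \<le> Re (cinner (X (Y x)) x)"
    unfolding eq by (rule positive_contraction_nonneg[OF Y])
  have "Re (cinner (X (Y x)) x) \<le> (norm (?S x))\<^sup>2"
    unfolding eq by (rule positive_contraction_upper[OF Y])
  also have "\<dots> \<le> (norm x)\<^sup>2"
    unfolding norm_sqrt_op_square[OF X] by (rule positive_contraction_upper[OF X])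
  finally show "Re (cinner (X (Y x)) x) \<le> (norm x)\<^sup>2" .
qed

text \<open>The vector \<open>y = P x - R x\<close> satisfies \<open>P y + R y = 0\<close>;
  positivity forces \<open>P y = R y = 0\<close>, and then
  \<open>cinner y y = cinner (P y - R y) x = 0\<close>.\<close>

lemma positive_square_root_unique:
  assumes P: "positive_contraction P" and R: "positive_contraction R"
    and comm: "\<And>x. P (R x) = R (P x)" and square: "\<And>x. P (P x) = R (R x)"
  shows "P x = R x"
proof -
  interpret P: bounded_linear P using P by (rule positive_contraction_bounded_linear)
  interpret R: bounded_linear R using R by (rule positive_contraction_bounded_linear)
  define y where "y = P x - R x"
  have "P y + R y = 0"
    by (simp add: y_def P.diff R.diff square comm)
  then have "Re (cinner (P y) y) + Re (cinner (R y) y) = 0"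
    by (metis cinner_add_left cinner.zero_left plus_complex.sel(1) zero_complex.sel(1))
  then have "Re (cinner (P y) y) = 0" "Re (cinner (R y) y) = 0"
    using positive_contraction_nonneg[OF P, of y] positive_contraction_nonneg[OF R, of y]
    by linarith+
  then have "P y = 0" "R y = 0"
    using positive_contraction_eq_zero P R by blast+
  then have "cinner y y = 0"
    using is_adjointD[OF positive_contraction_adjoint[OF P], of y x]
      is_adjointD[OF positive_contraction_adjoint[OF R], of y x]
    by (simp add: y_def[symmetric] cinner.diff_right flip: y_def) (simp add: y_def cinner.diff_right)
  then show ?thesis
    by (simp add: cinner_self y_def)
qed

section \<open>Operators on square-summable sequences\<close>

lemma l2seqI: "summable (\<lambda>n. (norm (f n))\<^sup>2) \<Longrightarrow> f \<in> l2seq"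
  by (simp add: l2seq_def)

lemma l2seqD: "f \<in> l2seq \<Longrightarrow> summable (\<lambda>n. (norm (f n))\<^sup>2)"
  by (simp add: l2seq_def)

lemma l2seq_pointwise:
  assumes f: "f \<in> l2seq" and K: "\<And>n. norm (g n) \<le> K * norm (f n)"
  shows "g \<in> l2seq"
proof (rule l2seqI, rule summable_comparison_test'[where N=0])
  show "summable (\<lambda>n. K\<^sup>2 * (norm (f n))\<^sup>2)"
    by (rule summable_mult[OF l2seqD[OF f]])
  show "norm ((norm (g n))\<^sup>2) \<le> K\<^sup>2 * (norm (f n))\<^sup>2" for n
    using power_mono[OF K[of n], of 2] by (simp add: power_mult_distrib)
qed

lemma l2seq_bounded_clinear:
  assumes "bounded_clinear G" "f \<in> l2seq"
  shows "(\<lambda>n. G (f n)) \<in> l2seq"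
proof -
  obtain K where "\<And>x. norm (G x) \<le> norm x * K"
    using assms(1) unfolding bounded_clinear_def by blast
  then show ?thesis
    by (intro l2seq_pointwise[OF assms(2), of _ K]) (simp add: mult.commute)
qed

lemma l2seq_scaleC: "f \<in> l2seq \<Longrightarrow> (\<lambda>n. c *\<^sub>C f n) \<in> l2seq"
  by (rule l2seq_pointwise[of f _ "cmod c"]) (simp_all add: norm_scaleC)

lemma l2seq_uminus: "f \<in> l2seq \<Longrightarrow> (\<lambda>n. - f n) \<in> l2seq"
  by (simp add: l2seq_def)

lemma l2seq_add:
  assumes "f \<in> l2seq" "g \<in> l2seq"
  shows "(\<lambda>n. f n + g n) \<in> l2seq"
proof (rule l2seqI, rule summable_comparison_test'[where N=0])
  show "summable (\<lambda>n. 2 * (norm (f n))\<^sup>2 + 2 * (norm (g n))\<^sup>2)"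
    using assms by (intro summable_add summable_mult l2seqD)
  show "norm ((norm (f n + g n))\<^sup>2) \<le> 2 * (norm (f n))\<^sup>2 + 2 * (norm (g n))\<^sup>2" for n
    using parallelogram_law[of "f n" "g n"] zero_le_power2[of "norm (f n - g n)"]
    by (simp only: real_norm_def abs_power2)
qed

lemma l2seq_diff: "f \<in> l2seq \<Longrightarrow> g \<in> l2seq \<Longrightarrow> (\<lambda>n. f n - g n) \<in> l2seq"
  using l2seq_add[of f "\<lambda>n. - g n"] l2seq_uminus by auto

lemma l2seq_zero: "(\<lambda>n. 0) \<in> l2seq"
  by (simp add: l2seq_def)

lemma l2seq_norm_le:
  assumes "f \<in> l2seq"
  shows "norm (f n) \<le> l2norm f"
proof -
  have "(norm (f n))\<^sup>2 \<le> (\<Sum>k. (norm (f k))\<^sup>2)"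
    using sum_le_suminf[OF l2seqD[OF assms], of "{n}"] by simp
  then show ?thesis
    unfolding l2norm_def by (rule real_le_rsqrt)
qed

lemma l2norm_le:
  assumes "g \<in> l2seq" "(\<Sum>n. (norm (f n))\<^sup>2) \<le> (\<Sum>n. (norm (g n))\<^sup>2)"
  shows "l2norm f \<le> l2norm g"
  using assms by (simp add: l2norm_def)

lemma norm_cinner_le_squares: "norm (cinner x y) \<le> (norm x)\<^sup>2 + (norm y)\<^sup>2"
  for x :: "'a::complex_inner"
proof -
  have "norm x * norm y \<le> (norm x)\<^sup>2 + (norm y)\<^sup>2"
    using sum_squares_bound[of "norm x" "norm y"] mult_nonneg_nonneg[OF norm_ge_zero norm_ge_zero, of x y]
    by linarith
  then show ?thesis
    using norm_cinner_le order_trans by blast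
qed

lemma summable_l2inner:
  assumes "f \<in> l2seq" "g \<in> l2seq"
  shows "summable (\<lambda>n. norm (cinner (f n) (g n)))" "summable (\<lambda>n. cinner (f n) (g n))"
proof -
  show "summable (\<lambda>n. norm (cinner (f n) (g n)))"
    by (rule summable_comparison_test'[OF summable_add[OF assms[THEN l2seqD]], of 0])
      (use norm_cinner_le_squares in simp)
  then show "summable (\<lambda>n. cinner (f n) (g n))"
    by (rule summable_norm_cancel)
qed

lemma l2inner_add_left:
  "f \<in> l2seq \<Longrightarrow> g \<in> l2seq \<Longrightarrow> h \<in> l2seq \<Longrightarrow>
    l2inner (\<lambda>n. f n + g n) h = l2inner f h + l2inner g h"
  unfolding l2inner_def by (simp add: cinner_add_left suminf_add[OF summable_l2inner(2) summable_l2inner(2)])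

lemma l2inner_diff_right:
  "f \<in> l2seq \<Longrightarrow> g \<in> l2seq \<Longrightarrow> h \<in> l2seq \<Longrightarrow>
    l2inner f (\<lambda>n. g n - h n) = l2inner f g - l2inner f h"
  unfolding l2inner_def by (simp add: cinner.diff_right suminf_diff[OF summable_l2inner(2) summable_l2inner(2)])

lemma l2inner_uminus_left:
  "f \<in> l2seq \<Longrightarrow> g \<in> l2seq \<Longrightarrow> l2inner (\<lambda>n. - f n) g = - l2inner f g"
  unfolding l2inner_def by (simp add: cinner.minus_left suminf_minus[OF summable_l2inner(2)])

lemma l2inner_pointwise_adjoint:
  "is_adjoint G H \<Longrightarrow> l2inner (\<lambda>n. G (f n)) g = l2inner f (\<lambda>n. H (g n))"
  by (simp add: l2inner_def is_adjointD)

section \<open>Selfadjoint contractions given by symmetric stochastic matrices\<close>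

definition symmetric_stochastic :: "(nat \<Rightarrow> nat \<Rightarrow> real) \<Rightarrow> bool" where
  "symmetric_stochastic m \<longleftrightarrow> (\<forall>i j. 0 \<le> m i j \<and> m i j = m j i) \<and> (\<forall>i. m i sums 1)"

definition matrix_op :: "(nat \<Rightarrow> nat \<Rightarrow> real) \<Rightarrow> (nat \<Rightarrow> 'a::chilbert_space) \<Rightarrow> nat \<Rightarrow> 'a" where
  "matrix_op m f n = (\<Sum>j. m n j *\<^sub>R f j)"

text \<open>Jensen's inequality for the square, obtained from the nonnegative variance of
  \<open>norm (h k)\<close> under the weights \<open>c\<close>; \<open>s\<close> is the
  mean.\<close>

lemma norm_convex_combination_square_le:
  fixes h :: "nat \<Rightarrow> 'a::banach"
  assumes c: "c sums 1" "\<And>k. 0 \<le> c k" and h: "\<And>k. norm (h k) \<le> K"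
  shows "(norm (\<Sum>k. c k *\<^sub>R h k))\<^sup>2 \<le> (\<Sum>k. c k * (norm (h k))\<^sup>2)"
    and "summable (\<lambda>k. c k * (norm (h k))\<^sup>2)"
proof -
  have csum: "summable c" using c(1) by (rule sums_summable)
  note bound = summable_scaleR_bounded[OF csum c(2) h]
  have "norm ((norm (h k))\<^sup>2) \<le> K\<^sup>2" for k
    using power_mono[OF h[of k], of 2] by simp
  from summable_scaleR_bounded(2)[OF csum c(2) this]
  show sq: "summable (\<lambda>k. c k * (norm (h k))\<^sup>2)" by simp
  define s where "s = (\<Sum>k. c k * norm (h k))"
  have s: "(\<lambda>k. c k * norm (h k)) sums s"
    using bound(1) c(2) by (simp add: s_def summable_sums)
  have "(\<lambda>k. c k * (norm (h k))\<^sup>2 - (2 * s) * (c k * norm (h k)) + s\<^sup>2 * c k) sums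
      ((\<Sum>k. c k * (norm (h k))\<^sup>2) - (2 * s) * s + s\<^sup>2 * 1)"
    by (intro sums_add sums_diff sums_mult summable_sums[OF sq] s c(1))
  moreover have "0 \<le> c k * (norm (h k))\<^sup>2 - (2 * s) * (c k * norm (h k)) + s\<^sup>2 * c k" for k
  proof -
    have "0 \<le> c k * (norm (h k) - s)\<^sup>2"
      using c(2) by simp
    also have "\<dots> = c k * (norm (h k))\<^sup>2 - (2 * s) * (c k * norm (h k)) + s\<^sup>2 * c k"
      by (simp add: power2_diff algebra_simps)
    finally show ?thesis .
  qed
  ultimately have "0 \<le> (\<Sum>k. c k * (norm (h k))\<^sup>2) - (2 * s) * s + s\<^sup>2 * 1"
    by (metis (no_types, lifting) sums_le sums_zero)
  then have "s\<^sup>2 \<le> (\<Sum>k. c k * (norm (h k))\<^sup>2)"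
    by (simp add: power2_eq_square)
  moreover have "norm (\<Sum>k. c k *\<^sub>R h k) \<le> s"
    using summable_norm[OF bound(1)] c(2) by (simp add: s_def)
  ultimately show "(norm (\<Sum>k. c k *\<^sub>R h k))\<^sup>2 \<le> (\<Sum>k. c k * (norm (h k))\<^sup>2)"
    by (meson norm_ge_zero order_trans power_mono)
qed

context
  fixes m :: "nat \<Rightarrow> nat \<Rightarrow> real"
  assumes m: "symmetric_stochastic m"
begin

lemma stochastic_nonneg: "0 \<le> m i j"
  and stochastic_symmetric: "m i j = m j i"
  and stochastic_sums: "m i sums 1"
  using m by (auto simp: symmetric_stochastic_def)

lemma stochastic_summable: "summable (m i)"
  using stochastic_sums by (rule sums_summable)

lemma summable_matrix_op:
  assumes "f \<in> l2seq"
  shows "summable (\<lambda>j. m n j *\<^sub>R (f j :: 'a::chilbert_space))"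
  by (rule summable_scaleR_bounded(2)[OF stochastic_summable stochastic_nonneg l2seq_norm_le[OF assms]])

text \<open>Jensen's inequality in each row, then summation over the columns (Schur's test).\<close>

lemma matrix_op_l2:
  assumes f: "f \<in> l2seq"
  shows matrix_op_l2seq: "matrix_op m f \<in> l2seq"
    and matrix_op_contraction: "(\<Sum>n. (norm (matrix_op m f n))\<^sup>2) \<le> (\<Sum>n. (norm (f n))\<^sup>2)"
proof -
  note jensen = norm_convex_combination_square_le[OF stochastic_sums stochastic_nonneg l2seq_norm_le[OF f]]
  have bound: "(\<Sum>n<N. (norm (matrix_op m f n))\<^sup>2) \<le> (\<Sum>n. (norm (f n))\<^sup>2)" for N
  proof -
    \<comment> \<open>By symmetry a partial column sum is a partial row sum.\<close>
    have column: "(\<Sum>n<N. m n j) \<le> 1" for j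
      using sum_le_suminf[OF stochastic_summable, of "{..<N}" j] stochastic_nonneg
        sums_unique[OF stochastic_sums, of j] by (simp add: stochastic_symmetric[of j])
    have "(\<Sum>n<N. (norm (matrix_op m f n))\<^sup>2) \<le> (\<Sum>n<N. \<Sum>j. m n j * (norm (f j))\<^sup>2)"
      unfolding matrix_op_def by (intro sum_mono jensen(1))
    also have "\<dots> = (\<Sum>j. \<Sum>n<N. m n j * (norm (f j))\<^sup>2)"
      by (rule suminf_sum[symmetric]) (rule jensen(2))
    also have "\<dots> \<le> (\<Sum>j. (norm (f j))\<^sup>2)"
    proof (rule suminf_le)
      show "summable (\<lambda>j. \<Sum>n<N. m n j * (norm (f j))\<^sup>2)"
        by (intro summable_sum jensen(2))
      show "(\<Sum>n<N. m n j * (norm (f j))\<^sup>2) \<le> (norm (f j))\<^sup>2" for j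
        using mult_right_mono[OF column[of j], of "(norm (f j))\<^sup>2"] by (simp add: sum_distrib_right)
    qed (rule l2seqD[OF f])
    finally show ?thesis .
  qed
  show "matrix_op m f \<in> l2seq"
    by (rule l2seqI, rule bounded_imp_summable) (use bound[of "Suc _"] lessThan_Suc_atMost in auto)
  then show "(\<Sum>n. (norm (matrix_op m f n))\<^sup>2) \<le> (\<Sum>n. (norm (f n))\<^sup>2)"
    by (intro suminf_le_const bound l2seqD)
qed

lemma matrix_op_bounded_linear:
  assumes "f \<in> l2seq" "bounded_clinear G"
  shows "G (matrix_op m f n) = matrix_op m (\<lambda>j. G (f j)) n"
proof -
  interpret G: bounded_linear G
    by (rule bounded_clinear_imp_bounded_linear[OF assms(2)])
  show ?thesis
    unfolding matrix_op_def by (simp add: G.suminf[OF summable_matrix_op[OF assms(1)]] G.scaleR)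
qed

lemma matrix_op_add:
  assumes "f \<in> l2seq" "g \<in> l2seq"
  shows "matrix_op m (\<lambda>j. f j + g j) n = matrix_op m f n + matrix_op m g n"
  unfolding matrix_op_def
  by (simp add: scaleR_add_right suminf_add[OF assms[THEN summable_matrix_op]])

lemma matrix_op_scaleC:
  assumes "f \<in> l2seq"
  shows "matrix_op m (\<lambda>j. c *\<^sub>C f j) n = c *\<^sub>C matrix_op m f n"
  unfolding matrix_op_def
  by (simp add: bounded_linear.suminf[OF bounded_linear_scaleC summable_matrix_op[OF assms]]
      scaleC_scaleR_commute)

text \<open>Symmetry reduces the claim to interchanging two sums. The terms are dominated by
  \<open>m n j\<close> times \<open>(norm (f j))\<^sup>2 + (norm (g n))\<^sup>2\<close>, summable
  over the grid because rows and columns sum to 1.\<close>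

lemma l2inner_matrix_op:
  fixes f g :: "nat \<Rightarrow> 'a::chilbert_space"
  assumes f: "f \<in> l2seq" and g: "g \<in> l2seq"
  shows "l2inner (matrix_op m f) g = l2inner f (matrix_op m g)"
proof -
  define F where "F n j = m n j *\<^sub>R cinner (f j) (g n)" for n j
  have row: "(\<lambda>j. m n j * t) summable_on UNIV" "(\<Sum>\<^sub>\<infinity>j. m n j * t) = t" for n t
  proof -
    have "summable (\<lambda>j. norm (m n j * t))"
      using summable_mult2[OF stochastic_summable, of n "\<bar>t\<bar>"] stochastic_nonneg by (simp add: abs_mult)
    then show *: "(\<lambda>j. m n j * t) summable_on UNIV"
      by (rule norm_summable_imp_summable_on)
    show "(\<Sum>\<^sub>\<infinity>j. m n j * t) = t"
      using suminf_eq_infsum[OF *] sums_unique[OF sums_mult2[OF stochastic_sums, of n t]] by simp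
  qed
  have weighted: "(\<lambda>p. norm (m (fst p) (snd p) * (norm (h (fst p)))\<^sup>2)) summable_on (UNIV \<times> UNIV)"
    if "h \<in> l2seq" for h :: "nat \<Rightarrow> 'a"
    using norm_summable_imp_summable_on[of "\<lambda>n. (norm (h n))\<^sup>2"] l2seqD[OF that] stochastic_nonneg
    by (subst Infinite_Sum.abs_summable_on_Sigma_iff) (simp add: abs_mult row)
  have "(\<lambda>p. norm (m (snd p) (fst p) * (norm (f (snd p)))\<^sup>2)) summable_on (UNIV \<times> UNIV)"
    using summable_on_reindex_bij_betw[OF bij_swap,
        of "\<lambda>p. norm (m (fst p) (snd p) * (norm (f (fst p)))\<^sup>2)"] weighted[OF f]
    by simp
  from summable_on_add[OF this weighted[OF g]]
  have "(\<lambda>p. norm (case p of (n, j) \<Rightarrow> F n j)) summable_on (UNIV \<times> UNIV)"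
  proof (rule Infinite_Sum.abs_summable_on_comparison_test')
    fix p :: "nat \<times> nat"
    obtain n j where p: "p = (n, j)" by (cases p)
    have "norm (F n j) \<le> m n j * ((norm (f j))\<^sup>2 + (norm (g n))\<^sup>2)"
      unfolding F_def using norm_cinner_le_squares[of "f j" "g n"] stochastic_nonneg[of n j]
      by (simp add: mult_left_mono)
    then show "norm (case p of (n, j) \<Rightarrow> F n j) \<le> norm (m (snd p) (fst p) * (norm (f (snd p)))\<^sup>2) +
        norm (m (fst p) (snd p) * (norm (g (fst p)))\<^sup>2)"
      using stochastic_nonneg[of n j] by (simp add: p stochastic_symmetric[of j n] algebra_simps)
  qed
  then have F_on: "(\<lambda>(n, j). F n j) summable_on (UNIV \<times> UNIV)"
    by (rule Infinite_Sum.abs_summable_summable)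
  have F_on': "(\<lambda>(j, n). F n j) summable_on (UNIV \<times> UNIV)"
    using summable_on_reindex_bij_betw[OF bij_swap, of "\<lambda>(n, j). F n j"] F_on by simp
  have "cinner (matrix_op m f n) (g n) = (\<Sum>j. F n j)" for n
    unfolding matrix_op_def F_def
    by (simp add: bounded_linear.suminf[OF cinner.bounded_linear_left summable_matrix_op[OF f]]
        cinner_scaleR_left)
  moreover have "summable (\<lambda>j. norm (F n j))" for n
  proof -
    have "norm (cinner (f j) (g n)) \<le> l2norm f * norm (g n)" for j
      by (rule order_trans[OF norm_cinner_le mult_right_mono[OF l2seq_norm_le[OF f]]]) simp
    then show ?thesis
      unfolding F_def by (rule summable_scaleR_bounded(1)[OF stochastic_summable stochastic_nonneg])
  qed
  ultimately have L: "cinner (matrix_op m f n) (g n) = (\<Sum>\<^sub>\<infinity>j. F n j)" for n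
    by (simp add: suminf_eq_infsum norm_summable_imp_summable_on)
  have "cinner (f j) (matrix_op m g j) = (\<Sum>n. F n j)" for j
    unfolding matrix_op_def F_def stochastic_symmetric[of _ j]
    by (simp add: bounded_linear.suminf[OF cinner.bounded_linear_right summable_matrix_op[OF g]]
        cinner_scaleR_right)
  moreover have "summable (\<lambda>n. norm (F n j))" for j
  proof -
    have "norm (cinner (f j) (g n)) \<le> norm (f j) * l2norm g" for n
      by (rule order_trans[OF norm_cinner_le mult_left_mono[OF l2seq_norm_le[OF g]]]) simp
    then show ?thesis
      unfolding F_def stochastic_symmetric[of _ j]
      by (rule summable_scaleR_bounded(1)[OF stochastic_summable stochastic_nonneg])
  qed
  ultimately have R: "cinner (f j) (matrix_op m g j) = (\<Sum>\<^sub>\<infinity>n. F n j)" for j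
    by (simp add: suminf_eq_infsum norm_summable_imp_summable_on)
  have "l2inner (matrix_op m f) g = (\<Sum>\<^sub>\<infinity>n. \<Sum>\<^sub>\<infinity>j. F n j)"
    unfolding l2inner_def L
    using summable_on_Sigma_banach[of F UNIV "\<lambda>_. UNIV"] F_on by (intro suminf_eq_infsum) simp
  also have "\<dots> = (\<Sum>\<^sub>\<infinity>j. \<Sum>\<^sub>\<infinity>n. F n j)"
    by (rule infsum_swap_banach[OF F_on])
  also have "\<dots> = l2inner f (matrix_op m g)"
    unfolding l2inner_def R
    using summable_on_Sigma_banach[of "\<lambda>j n. F n j" UNIV "\<lambda>_. UNIV"] F_on'
    by (intro suminf_eq_infsum[symmetric]) simp
  finally show ?thesis .
qed

end

text \<open>Realises the direct sum of two sequence spaces inside a single one, since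
  \<open>normal_op_l2\<close> speaks of operators on one sequence space.\<close>

definition interleave :: "(nat \<Rightarrow> 'a) \<Rightarrow> (nat \<Rightarrow> 'a) \<Rightarrow> nat \<Rightarrow> 'a" where
  "interleave a b n = (if even n then a (n div 2) else b (n div 2))"

definition evens :: "(nat \<Rightarrow> 'a) \<Rightarrow> nat \<Rightarrow> 'a" where
  "evens f = (\<lambda>n. f (2 * n))"

definition odds :: "(nat \<Rightarrow> 'a) \<Rightarrow> nat \<Rightarrow> 'a" where
  "odds f = (\<lambda>n. f (2 * n + 1))"

lemma evens_interleave [simp]: "evens (interleave a b) = a"
  and odds_interleave [simp]: "odds (interleave a b) = b"
  by (simp_all add: interleave_def evens_def odds_def fun_eq_iff)

lemma interleave_pointwise2:
  "interleave (\<lambda>n. h (a n) (c n)) (\<lambda>n. h (b n) (d n)) =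
    (\<lambda>n. h (interleave a b n) (interleave c d n))"
  by (auto simp: interleave_def)

lemma interleave_pointwise:
  "interleave (\<lambda>n. h (a n)) (\<lambda>n. h (b n)) = (\<lambda>n. h (interleave a b n))"
  by (auto simp: interleave_def)

lemma suminf_evens_odds:
  fixes f :: "nat \<Rightarrow> 'b::real_normed_vector"
  assumes "summable f" "summable (evens f)" "summable (odds f)"
  shows "(\<Sum>n. f n) = (\<Sum>n. evens f n) + (\<Sum>n. odds f n)"
proof -
  have "(\<lambda>n. sum f {n * 2..<n * 2 + 2}) sums suminf f"
    by (intro sums_group summable_sums assms) simp
  moreover have "sum f {n * 2..<n * 2 + 2} = evens f n + odds f n" for n
    by (simp add: evens_def odds_def numeral_2_eq_2 mult.commute)
  ultimately show ?thesis
    using suminf_add[OF assms(2,3)] by (simp add: sums_iff)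
qed

lemma l2seq_evens: "f \<in> l2seq \<Longrightarrow> evens f \<in> l2seq"
  using summable_reindex[of "\<lambda>n. (norm (f n))\<^sup>2" "\<lambda>n. 2 * n"]
  by (simp add: l2seq_def inj_def o_def evens_def odds_def)

lemma l2seq_odds: "f \<in> l2seq \<Longrightarrow> odds f \<in> l2seq"
  using summable_reindex[of "\<lambda>n. (norm (f n))\<^sup>2" "\<lambda>n. 2 * n + 1"]
  by (simp add: l2seq_def inj_def o_def evens_def odds_def)

lemma l2seq_interleave:
  assumes "a \<in> l2seq" "b \<in> l2seq"
  shows "interleave a b \<in> l2seq"
proof (rule l2seqI)
  have "(\<lambda>n. if even n then (norm (a (n div 2)))\<^sup>2 else (norm (b ((n - 1) div 2)))\<^sup>2) sums
      ((\<Sum>n. (norm (b n))\<^sup>2) + (\<Sum>n. (norm (a n))\<^sup>2))"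
    using assms by (intro sums_if summable_sums l2seqD)
  moreover have "(\<lambda>n. (norm (interleave a b n))\<^sup>2) =
      (\<lambda>n. if even n then (norm (a (n div 2)))\<^sup>2 else (norm (b ((n - 1) div 2)))\<^sup>2)"
    by (intro ext) (auto simp: interleave_def elim!: oddE)
  ultimately show "summable (\<lambda>n. (norm (interleave a b n))\<^sup>2)"
    by (simp add: sums_iff)
qed

lemma l2inner_evens_odds:
  assumes "f \<in> l2seq" "g \<in> l2seq"
  shows "l2inner f g = l2inner (evens f) (evens g) + l2inner (odds f) (odds g)"
  using suminf_evens_odds[of "\<lambda>n. cinner (f n) (g n)"] summable_l2inner(2)[OF assms]
    summable_l2inner(2)[OF assms[THEN l2seq_evens]] summable_l2inner(2)[OF assms[THEN l2seq_odds]]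
  by (simp add: l2inner_def evens_def odds_def)

lemma suminf_norm_square_evens_odds:
  assumes "f \<in> l2seq"
  shows "(\<Sum>n. (norm (f n))\<^sup>2) = (\<Sum>n. (norm (evens f n))\<^sup>2) + (\<Sum>n. (norm (odds f n))\<^sup>2)"
  using suminf_evens_odds[of "\<lambda>n. (norm (f n))\<^sup>2"] l2seqD[OF assms]
    l2seqD[OF l2seq_evens[OF assms]] l2seqD[OF l2seq_odds[OF assms]]
  by (simp add: evens_def odds_def)

text \<open>Halmos' unitary extension \<open>[[W, D], [0, -W\<^sup>*]]\<close>, \<open>D = I - W W\<^sup>*\<close>, of the isometry \<open>W\<close>,
  tensored with the selfadjoint contraction given by \<open>m\<close>; the two copies of the space sit at the
  even and at the odd positions.\<close>

lemma isometry_tensor_stochastic_normal_extension: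
  fixes W Ws :: "'a::chilbert_space \<Rightarrow> 'a"
  assumes m: "symmetric_stochastic m" and W: "bounded_clinear W" and adj: "is_adjoint W Ws"
    and iso: "\<And>x. Ws (W x) = x"
  obtains N :: "(nat \<Rightarrow> 'a) \<Rightarrow> nat \<Rightarrow> 'a" where "normal_op_l2 N"
    and "\<And>f. f \<in> l2seq \<Longrightarrow>
      N (interleave f (\<lambda>n. 0)) = interleave (matrix_op m (\<lambda>n. W (f n))) (\<lambda>n. 0)"
proof -
  define D where "D x = x - W (Ws x)" for x
  have Ws: "bounded_clinear Ws"
    using bounded_clinear_adjoint[OF adj W] .
  have D: "bounded_clinear D"
    unfolding D_def
    by (rule bounded_clinear_diff[OF bounded_clinear_ident bounded_clinear_compose[OF W Ws]])
  have D_adj: "is_adjoint D D"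
    unfolding D_def
    by (rule is_adjoint_diff[OF is_adjoint_ident is_adjoint_compose[OF adj is_adjoint_sym[OF adj]]])
  have adjs: "is_adjoint Ws W"
    by (rule is_adjoint_sym[OF adj])
  interpret W: bounded_linear W by (rule bounded_clinear_imp_bounded_linear[OF W])
  interpret Ws: bounded_linear Ws by (rule bounded_clinear_imp_bounded_linear[OF Ws])
  interpret D: bounded_linear D by (rule bounded_clinear_imp_bounded_linear[OF D])
  have linC: "W (c *\<^sub>C x) = c *\<^sub>C W x" "Ws (c *\<^sub>C x) = c *\<^sub>C Ws x" "D (c *\<^sub>C x) = c *\<^sub>C D x" for c x
    using W Ws D by (auto simp: bounded_clinear_def)
  have DW: "D (W x) = 0" and WsD: "Ws (D x) = 0" and DD: "D (D x) = D x"
    and WWs: "W (Ws x) = x - D x" for x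
    by (simp_all add: D_def Ws.diff W.diff iso)
  \<comment> \<open>\<open>U1\<close>, \<open>U2\<close> are the rows of the unitary and
    \<open>V1\<close>, \<open>V2\<close> those of its adjoint
    \<open>[[W\<^sup>*, 0], [D, - W]]\<close>.\<close>
  define U1 where "U1 f = (\<lambda>j. W (evens f j) + D (odds f j))" for f
  define U2 where "U2 f = (\<lambda>j. - Ws (odds f j))" for f
  define V1 where "V1 f = (\<lambda>j. Ws (evens f j))" for f
  define V2 where "V2 f = (\<lambda>j. D (evens f j) - W (odds f j))" for f
  define N where "N f = interleave (matrix_op m (U1 f)) (matrix_op m (U2 f))" for f
  define Na where "Na f = interleave (matrix_op m (V1 f)) (matrix_op m (V2 f))" for f
  note l2 = l2seq_evens l2seq_odds l2seq_bounded_clinear[OF W] l2seq_bounded_clinear[OF Ws]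
    l2seq_bounded_clinear[OF D] l2seq_add l2seq_diff l2seq_uminus l2seq_scaleC
    matrix_op_l2seq[OF m] l2seq_interleave l2seq_zero
  have U: "U1 f \<in> l2seq" "U2 f \<in> l2seq" if "f \<in> l2seq" for f
    unfolding U1_def U2_def using that by (intro l2; assumption)+
  have V: "V1 f \<in> l2seq" "V2 f \<in> l2seq" if "f \<in> l2seq" for f
    unfolding V1_def V2_def using that by (intro l2; assumption)+
  have N_l2: "N f \<in> l2seq" and Na_l2: "Na f \<in> l2seq" if "f \<in> l2seq" for f
    unfolding N_def Na_def using that by (simp_all add: l2 U V)
  have evens_N: "evens (N f) = matrix_op m (U1 f)" and odds_N: "odds (N f) = matrix_op m (U2 f)"
    and evens_Na: "evens (Na f) = matrix_op m (V1 f)" and odds_Na: "odds (Na f) = matrix_op m (V2 f)"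
    for f by (simp_all add: N_def Na_def)
  have push: "matrix_op m (\<lambda>j. W (f j)) = (\<lambda>n. W (matrix_op m f n))"
    "matrix_op m (\<lambda>j. Ws (f j)) = (\<lambda>n. Ws (matrix_op m f n))"
    "matrix_op m (\<lambda>j. D (f j)) = (\<lambda>n. D (matrix_op m f n))"
    if "f \<in> l2seq" for f
    using matrix_op_bounded_linear[OF m that W] matrix_op_bounded_linear[OF m that Ws]
      matrix_op_bounded_linear[OF m that D] by (simp_all add: fun_eq_iff)
  have uminus: "matrix_op m (\<lambda>j. - f j) = (\<lambda>n. - matrix_op m f n)" if "f \<in> l2seq" for f :: "nat \<Rightarrow> 'a"
    unfolding matrix_op_def using suminf_minus[OF summable_matrix_op[OF m that]] by auto
  have add: "matrix_op m (\<lambda>j. f j + g j) = (\<lambda>n. matrix_op m f n + matrix_op m g n)"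
    if "f \<in> l2seq" "g \<in> l2seq" for f g :: "nat \<Rightarrow> 'a"
    using matrix_op_add[OF m that] by auto
  have diff: "matrix_op m (\<lambda>j. f j - g j) = (\<lambda>n. matrix_op m f n - matrix_op m g n)"
    if "f \<in> l2seq" "g \<in> l2seq" for f g :: "nat \<Rightarrow> 'a"
    using add[OF that(1) l2seq_uminus[OF that(2)]] uminus[OF that(2)] by simp
  have scale: "matrix_op m (\<lambda>j. c *\<^sub>C f j) = (\<lambda>n. c *\<^sub>C matrix_op m f n)"
    if "f \<in> l2seq" for f :: "nat \<Rightarrow> 'a" and c
    using matrix_op_scaleC[OF m that] by auto
  have parts: "evens (\<lambda>n. f n + g n) = (\<lambda>n. evens f n + evens g n)"
    "odds (\<lambda>n. f n + g n) = (\<lambda>n. odds f n + odds g n)"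
    "evens (\<lambda>n. c *\<^sub>C f n) = (\<lambda>n. c *\<^sub>C evens f n)"
    "odds (\<lambda>n. c *\<^sub>C f n) = (\<lambda>n. c *\<^sub>C odds f n)" for f g :: "nat \<Rightarrow> 'a" and c
    by (simp_all add: evens_def odds_def)
  have mU1: "matrix_op m (U1 f) = (\<lambda>n. W (matrix_op m (evens f) n) + D (matrix_op m (odds f) n))"
    and mU2: "matrix_op m (U2 f) = (\<lambda>n. - Ws (matrix_op m (odds f) n))"
    and mV1: "matrix_op m (V1 f) = (\<lambda>n. Ws (matrix_op m (evens f) n))"
    and mV2: "matrix_op m (V2 f) = (\<lambda>n. D (matrix_op m (evens f) n) - W (matrix_op m (odds f) n))"
    if "f \<in> l2seq" for f
    using that unfolding U1_def U2_def V1_def V2_def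
    by (simp_all add: add diff uminus push l2)
  \<comment> \<open>The matrix \<open>m\<close> commutes with \<open>W\<close>, \<open>Ws\<close>
    and \<open>D\<close>, and the unitary cancels against its adjoint; in either order
    \<open>m\<close> applied twice remains on each half.\<close>
  have normal: "N (Na f) = Na (N f)" if f: "f \<in> l2seq" for f
  proof -
    have e: "matrix_op m (evens f) \<in> l2seq" and o: "matrix_op m (odds f) \<in> l2seq"
      using f by (intro l2; assumption)+
    let ?e = "matrix_op m (matrix_op m (evens f))"
    let ?o = "matrix_op m (matrix_op m (odds f))"
    have "N (Na f) = interleave ?e ?o"
      unfolding N_def mU1[OF Na_l2[OF f]] mU2[OF Na_l2[OF f]] evens_Na odds_Na mV1[OF f] mV2[OF f]
      by (simp add: push add diff uminus l2 e o D.diff Ws.diff WsD DW DD iso WWs)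
    also have "\<dots> = Na (N f)"
      unfolding Na_def mV1[OF N_l2[OF f]] mV2[OF N_l2[OF f]] evens_N odds_N mU1[OF f] mU2[OF f]
      by (simp add: push add diff uminus l2 e o D.add Ws.add W.neg WsD DW DD iso WWs)
    finally show ?thesis .
  qed
  have adjoint: "l2inner (N f) g = l2inner f (Na g)" if f: "f \<in> l2seq" and g: "g \<in> l2seq" for f g
  proof -
    let ?ge = "matrix_op m (evens g)"
    let ?go = "matrix_op m (odds g)"
    have "l2inner (N f) g = l2inner (U1 f) ?ge + l2inner (U2 f) ?go"
      unfolding l2inner_evens_odds[OF N_l2[OF f] g] evens_N odds_N
      by (simp add: l2inner_matrix_op[OF m] U f l2 g)
    also have "\<dots> = l2inner (evens f) (\<lambda>n. Ws (?ge n)) + l2inner (odds f) (\<lambda>n. D (?ge n))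
        - l2inner (odds f) (\<lambda>n. W (?go n))"
      unfolding U1_def U2_def using f g
      by (simp add: l2inner_add_left l2inner_uminus_left l2 l2inner_pointwise_adjoint[OF adj]
          l2inner_pointwise_adjoint[OF adjs] l2inner_pointwise_adjoint[OF D_adj])
    also have "\<dots> = l2inner f (Na g)"
      unfolding l2inner_evens_odds[OF f Na_l2[OF g]] evens_Na odds_Na mV1[OF g] mV2[OF g] using f g
      by (simp add: l2inner_diff_right l2)
    finally show ?thesis .
  qed
  have bounded: "l2norm (N f) \<le> l2norm f" if f: "f \<in> l2seq" for f
  proof (rule l2norm_le[OF f])
    \<comment> \<open>The unitary preserves the norm at each index; afterwards \<open>m\<close> can
      only decrease the total.\<close>
    have "(norm (U1 f n))\<^sup>2 + (norm (U2 f n))\<^sup>2 = (norm (evens f n))\<^sup>2 + (norm (odds f n))\<^sup>2" for n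
      unfolding U1_def U2_def Re_cinner_self[symmetric]
      by (simp add: cinner_add_left cinner_add_right cinner.minus_left cinner.minus_right
          is_adjointD[OF adj] is_adjointD[OF adjs] is_adjointD[OF D_adj] iso WsD DW DD WWs
          cinner.diff_right cinner.zero_right)
    then have pointwise: "(\<Sum>n. (norm (U1 f n))\<^sup>2) + (\<Sum>n. (norm (U2 f n))\<^sup>2) =
        (\<Sum>n. (norm (evens f n))\<^sup>2) + (\<Sum>n. (norm (odds f n))\<^sup>2)"
      using f by (simp add: suminf_add l2seqD U l2)
    have "(\<Sum>n. (norm (N f n))\<^sup>2) \<le> (\<Sum>n. (norm (U1 f n))\<^sup>2) + (\<Sum>n. (norm (U2 f n))\<^sup>2)"
      unfolding suminf_norm_square_evens_odds[OF N_l2[OF f]]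
      using matrix_op_contraction[OF m U(1)[OF f]] matrix_op_contraction[OF m U(2)[OF f]]
      by (simp add: N_def)
    also have "\<dots> = (\<Sum>n. (norm (f n))\<^sup>2)"
      unfolding pointwise suminf_norm_square_evens_odds[OF f] ..
    finally show "(\<Sum>n. (norm (N f n))\<^sup>2) \<le> (\<Sum>n. (norm (f n))\<^sup>2)" .
  qed
  have "normal_op_l2 N"
    unfolding normal_op_l2_def
  proof (intro conjI ballI allI)
    fix f g :: "nat \<Rightarrow> 'a" and c
    assume f: "f \<in> l2seq"
    show "N f \<in> l2seq" by (rule N_l2[OF f])
    show "N (\<lambda>n. c *\<^sub>C f n) = (\<lambda>n. c *\<^sub>C N f n)"
      unfolding N_def mU1[OF f] mU2[OF f] mU1[OF l2seq_scaleC[OF f]] mU2[OF l2seq_scaleC[OF f]]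
      unfolding interleave_pointwise[symmetric] using f
      by (simp add: parts scale l2 linC scaleC_add_right scaleC_minus_right)
    assume g: "g \<in> l2seq"
    show "N (\<lambda>n. f n + g n) = (\<lambda>n. N f n + N g n)"
      unfolding N_def mU1[OF f] mU2[OF f] mU1[OF g] mU2[OF g]
        mU1[OF l2seq_add[OF f g]] mU2[OF l2seq_add[OF f g]]
      unfolding interleave_pointwise2[symmetric] using f g
      by (simp add: parts add l2 W.add D.add Ws.add ac_simps)
  next
    show "\<exists>K. \<forall>f\<in>l2seq. l2norm (N f) \<le> K * l2norm f"
      using bounded by (intro exI[of _ 1]) simp
    show "\<exists>Nadj. (\<forall>g\<in>l2seq. Nadj g \<in> l2seq) \<and>
        (\<forall>f\<in>l2seq. \<forall>g\<in>l2seq. l2inner (N f) g = l2inner f (Nadj g)) \<and>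
        (\<forall>f\<in>l2seq. N (Nadj f) = Nadj (N f))"
      using Na_l2 adjoint normal by (intro exI[of _ Na]) blast
  qed
  moreover have "N (interleave f (\<lambda>n. 0)) = interleave (matrix_op m (\<lambda>n. W (f n))) (\<lambda>n. 0)" for f
  proof -
    have "matrix_op m (\<lambda>j. 0) = (\<lambda>n. 0 :: 'a)"
      by (simp add: matrix_op_def fun_eq_iff)
    then show ?thesis
      by (simp add: N_def U1_def U2_def D.zero Ws.zero)
  qed
  ultimately show thesis
    using that by blast
qed

section \<open>A stochastic matrix\<close>

text \<open>The generating function is \<open>2 / (3 - z - w - z w)\<close>. In the orthonormal basis of Laguerre
  functions the matrix represents multiplication by \<open>exp (- y / 2)\<close> on \<open>L\<^sup>2(0, \<infinity>)\<close>.\<close>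

fun laguerre_matrix :: "nat \<Rightarrow> nat \<Rightarrow> real" where
  "laguerre_matrix 0 0 = 2 / 3"
| "laguerre_matrix 0 (Suc j) = laguerre_matrix 0 j / 3"
| "laguerre_matrix (Suc k) 0 = laguerre_matrix k 0 / 3"
| "laguerre_matrix (Suc k) (Suc j) =
    (laguerre_matrix (Suc k) j + laguerre_matrix k (Suc j) + laguerre_matrix k j) / 3"

lemma laguerre_matrix_nonneg: "0 \<le> laguerre_matrix k j"
  by (induction k j rule: laguerre_matrix.induct) auto

lemma laguerre_matrix_symmetric: "laguerre_matrix k j = laguerre_matrix j k"
  by (induction k j rule: laguerre_matrix.induct) auto

text \<open>Summing the recursion expresses three times the partial sum of row \<open>k + 1\<close>
  through one shorter sum of that row and two sums of row \<open>k\<close>, each at most 1.\<close>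

lemma sum_laguerre_matrix_le: "(\<Sum>j<N. laguerre_matrix k j) \<le> 1"
proof (induction k arbitrary: N)
  case 0
  show ?case
  proof (induction N)
    case (Suc N)
    then show ?case
      by (simp add: sum.lessThan_Suc_shift del: sum.lessThan_Suc flip: sum_divide_distrib)
  qed simp
next
  case (Suc k)
  note outer = Suc.IH
  show ?case
  proof (induction N)
    case (Suc N)
    have "3 * (\<Sum>j<Suc N. laguerre_matrix (Suc k) j) =
        (\<Sum>j<N. laguerre_matrix (Suc k) j) + (\<Sum>j<Suc N. laguerre_matrix k j) + (\<Sum>j<N. laguerre_matrix k j)"
      by (simp add: sum.lessThan_Suc_shift sum.distrib add_divide_distrib distrib_left
          del: sum.lessThan_Suc flip: sum_divide_distrib)
    then show ?case
      using Suc.IH outer[of N] outer[of "Suc N"] by simp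
  qed simp
qed

lemma summable_laguerre_matrix: "summable (laguerre_matrix k)"
  by (rule bounded_imp_summable[OF laguerre_matrix_nonneg, where B=1])
    (metis sum_laguerre_matrix_le lessThan_Suc_atMost)

text \<open>Row \<open>k\<close> has the generating function
  \<open>2 / (3 - z) * ((1 + z) / (3 - z)) ^ k\<close>. The two equations state this at
  \<open>z = Z\<close> with the denominators cleared, so no inverse of \<open>3 - Z\<close> is
  required.\<close>

lemma laguerre_matrix_functional_calculus:
  fixes Z :: "'a::banach \<Rightarrow> 'a"
  assumes Z: "bounded_linear Z" and K: "\<And>n. norm ((Z ^^ n) x) \<le> K"
  defines "y \<equiv> \<lambda>k. \<Sum>j. laguerre_matrix k j *\<^sub>R (Z ^^ j) x"
  shows "3 *\<^sub>R y 0 - Z (y 0) = 2 *\<^sub>R x"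
    and "3 *\<^sub>R y (Suc k) - Z (y (Suc k)) = y k + Z (y k)"
proof -
  interpret Z: bounded_linear Z by fact
  let ?r = laguerre_matrix
  have a: "(\<lambda>j. ?r k j *\<^sub>R (Z ^^ j) x) sums y k" for k
    unfolding y_def
    by (intro summable_sums summable_scaleR_bounded(2)[OF summable_laguerre_matrix laguerre_matrix_nonneg K])
  have b: "(\<lambda>j. ?r k j *\<^sub>R (Z ^^ Suc j) x) sums Z (y k)" for k
    using Z.sums[OF a[of k]] by (simp add: Z.scaleR)
  have c: "(\<lambda>j. ?r k (Suc j) *\<^sub>R (Z ^^ Suc j) x) sums (y k - ?r k 0 *\<^sub>R x)" for k
    using a[of k] by (subst sums_Suc_iff) simp
  have "(\<lambda>j. 3 *\<^sub>R (?r 0 (Suc j) *\<^sub>R (Z ^^ Suc j) x)) sums (3 *\<^sub>R (y 0 - ?r 0 0 *\<^sub>R x))"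
    by (rule sums_scaleR_right[OF c])
  then have "(\<lambda>j. ?r 0 j *\<^sub>R (Z ^^ Suc j) x) sums (3 *\<^sub>R (y 0 - ?r 0 0 *\<^sub>R x))"
    by simp
  then have "Z (y 0) = 3 *\<^sub>R (y 0 - ?r 0 0 *\<^sub>R x)"
    by (rule sums_unique2[OF b])
  then show "3 *\<^sub>R y 0 - Z (y 0) = 2 *\<^sub>R x"
    by (simp add: scaleR_diff_right)
  have "(\<lambda>j. 3 *\<^sub>R (?r (Suc k) (Suc j) *\<^sub>R (Z ^^ Suc j) x)) sums (3 *\<^sub>R (y (Suc k) - ?r (Suc k) 0 *\<^sub>R x))"
    by (rule sums_scaleR_right[OF c])
  moreover have "3 *\<^sub>R (?r (Suc k) (Suc j) *\<^sub>R (Z ^^ Suc j) x) = ?r (Suc k) j *\<^sub>R (Z ^^ Suc j) x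
      + ?r k (Suc j) *\<^sub>R (Z ^^ Suc j) x + ?r k j *\<^sub>R (Z ^^ Suc j) x" for j
    by (simp flip: scaleR_add_left)
  ultimately have "(\<lambda>j. ?r (Suc k) j *\<^sub>R (Z ^^ Suc j) x + ?r k (Suc j) *\<^sub>R (Z ^^ Suc j) x
      + ?r k j *\<^sub>R (Z ^^ Suc j) x) sums (3 *\<^sub>R (y (Suc k) - ?r (Suc k) 0 *\<^sub>R x))"
    by simp
  moreover have "(\<lambda>j. ?r (Suc k) j *\<^sub>R (Z ^^ Suc j) x + ?r k (Suc j) *\<^sub>R (Z ^^ Suc j) x
      + ?r k j *\<^sub>R (Z ^^ Suc j) x) sums (Z (y (Suc k)) + (y k - ?r k 0 *\<^sub>R x) + Z (y k))"
    by (intro sums_add b c)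
  ultimately have "3 *\<^sub>R (y (Suc k) - ?r (Suc k) 0 *\<^sub>R x) = Z (y (Suc k)) + (y k - ?r k 0 *\<^sub>R x) + Z (y k)"
    by (rule sums_unique2)
  then show "3 *\<^sub>R y (Suc k) - Z (y (Suc k)) = y k + Z (y k)"
    by (simp add: scaleR_diff_right algebra_simps)
qed

text \<open>Evaluation at \<open>z = 1\<close>, where every row generating function equals
  1.\<close>

lemma laguerre_matrix_sums: "laguerre_matrix k sums 1"
proof -
  have pow: "((\<lambda>x. x) ^^ n) 1 = (1::real)" for n
    by (induction n) auto
  note calculus = laguerre_matrix_functional_calculus[of "\<lambda>x. x" "1::real" 1, unfolded pow]
  have "(\<Sum>j. laguerre_matrix k j) = 1"
  proof (induction k)
    case 0
    then show ?case using calculus(1) by simp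
  next
    case (Suc k)
    then show ?case using calculus(2)[of k] by simp
  qed
  then show ?thesis
    using summable_laguerre_matrix by (simp add: sums_iff)
qed

text \<open>The added 1 by 1 identity block acts on the coordinate reserved for
  \<open>ker (A - I)\<close>, where \<open>T\<close> is isometric.\<close>

fun extended_laguerre_matrix :: "nat \<Rightarrow> nat \<Rightarrow> real" where
  "extended_laguerre_matrix 0 j = (if j = 0 then 1 else 0)"
| "extended_laguerre_matrix (Suc i) 0 = 0"
| "extended_laguerre_matrix (Suc i) (Suc j) = laguerre_matrix i j"

lemma symmetric_stochastic_extended_laguerre_matrix: "symmetric_stochastic extended_laguerre_matrix"
  unfolding symmetric_stochastic_def
proof (intro conjI allI)
  fix i j
  show "0 \<le> extended_laguerre_matrix i j"
    by (cases i; cases j) (auto simp: laguerre_matrix_nonneg)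
  show "extended_laguerre_matrix i j = extended_laguerre_matrix j i"
    by (cases i; cases j) (auto simp: laguerre_matrix_symmetric)
  show "extended_laguerre_matrix i sums 1"
  proof (cases i)
    case 0
    have "extended_laguerre_matrix 0 = (\<lambda>j. if j = 0 then 1 else 0)"
      by (rule ext) simp
    then show ?thesis
      using 0 sums_single[of 0 "\<lambda>_. 1::real"] by simp
  next
    case (Suc k)
    then show ?thesis
      using sums_Suc[of "extended_laguerre_matrix i" 1] laguerre_matrix_sums[of k] by simp
  qed
qed

lemma matrix_op_extended_laguerre_matrix:
  "matrix_op extended_laguerre_matrix f 0 = f 0"
  "f \<in> l2seq \<Longrightarrow> matrix_op extended_laguerre_matrix f (Suc k) = (\<Sum>j. laguerre_matrix k j *\<^sub>R f (Suc j))"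
proof -
  have "(\<lambda>j. extended_laguerre_matrix 0 j *\<^sub>R f j) = (\<lambda>j. if j = 0 then f j else 0)"
    by auto
  then show "matrix_op extended_laguerre_matrix f 0 = f 0"
    using sums_unique[OF sums_single[of 0 f]] by (simp add: matrix_op_def)
  assume "f \<in> l2seq"
  from suminf_split_head[OF summable_matrix_op[OF symmetric_stochastic_extended_laguerre_matrix this, of "Suc k"]]
  show "matrix_op extended_laguerre_matrix f (Suc k) = (\<Sum>j. laguerre_matrix k j *\<^sub>R f (Suc j))"
    by (simp add: matrix_op_def)
qed

section \<open>Algebra of a 2-isometry with the kernel condition\<close>

text \<open>An everywhere defined symmetric map is automatically linear, and
  \<open>X\<^sup>2 <= X\<close> with Cauchy-Schwarz bounds its norm. This suits operators that arise
  as inverses.\<close>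

lemma adjoint_positive_contractionI:
  assumes adj: "is_adjoint X X" and le: "\<And>x. (norm (X x))\<^sup>2 \<le> Re (cinner (X x) x)"
  shows "positive_contraction X"
proof -
  have norm_le: "norm (X x) \<le> norm x" for x
  proof (cases "X x = 0")
    case False
    have "norm (X x) * norm (X x) \<le> norm (X x) * norm x"
      using order_trans[OF le Re_cinner_le] by (simp add: power2_eq_square)
    then show ?thesis
      using False by simp
  qed simp
  have move: "cinner z (X x) = cinner (X z) x" for x z
    using is_adjointD[OF adj] by simp
  have "X (x + y) = X x + X y" for x y
    by (rule cinner_eqI_right) (simp add: move cinner_add_right)
  moreover have "X (c *\<^sub>C x) = c *\<^sub>C X x" for c x
    by (rule cinner_eqI_right) (simp add: move cinner_scaleC_right)
  ultimately have "bounded_clinear X"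
    unfolding bounded_clinear_def using norm_le by (metis mult.right_neutral)
  moreover have "0 \<le> Re (cinner (X x) x)" for x
    using le order_trans zero_le_power2 by blast
  moreover have "Re (cinner (X x) x) \<le> (norm x)\<^sup>2" for x
    using order_trans[OF Re_cinner_le mult_right_mono[OF norm_le norm_ge_zero]]
    by (simp add: power2_eq_square)
  ultimately show ?thesis
    using adj by (simp add: positive_contraction_def)
qed

text \<open>With \<open>a n\<close> the square of \<open>norm ((Z ^^ n) x)\<close>, the squared
  distance of two even powers is \<open>a (2 * i) + a (2 * j) - 2 * a (i + j)\<close>, and
  \<open>a\<close> decreases to a limit. Even exponents are taken because an eigenvalue -1 makes the
  full sequence oscillate.\<close>

lemma even_powers_converge:
  fixes Z :: "'a::chilbert_space \<Rightarrow> 'a"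
  assumes adj: "is_adjoint Z Z" and contr: "\<And>x. norm (Z x) \<le> norm x"
  shows "convergent (\<lambda>n. (Z ^^ (2 * n)) x)"
proof -
  define a where "a n = (norm ((Z ^^ n) x))\<^sup>2" for n
  have a: "Re (cinner ((Z ^^ i) x) ((Z ^^ j) x)) = a n" if "i + j = 2 * n" for i j n
  proof -
    have "cinner ((Z ^^ i) x) ((Z ^^ j) x) = cinner x ((Z ^^ (i + j)) x)"
      using is_adjointD[OF is_adjoint_funpow[OF adj]] by (simp add: funpow_add)
    also have "\<dots> = cinner ((Z ^^ n) x) ((Z ^^ n) x)"
      using is_adjointD[OF is_adjoint_funpow[OF adj]]
      by (simp add: that mult_2 funpow_add)
    finally show ?thesis
      by (simp only: a_def Re_cinner_self)
  qed
  have "decseq a"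
    by (rule decseq_SucI) (simp add: a_def contr power_mono)
  then obtain l where l: "a \<longlonglongrightarrow> l" "\<And>n. l \<le> a n"
    using decseq_convergent[of a 0] by (auto simp: a_def)
  have dist: "(norm ((Z ^^ (2 * i)) x - (Z ^^ (2 * j)) x))\<^sup>2 \<le> (a (2 * i) - l) + (a (2 * j) - l)" for i j
    using a[of "2 * i" "2 * i" "2 * i"] a[of "2 * j" "2 * j" "2 * j"] a[of "2 * i" "2 * j" "i + j"]
      l(2)[of "i + j"]
    by (simp add: norm_diff_square Re_cinner_self)
  have "Cauchy (\<lambda>n. (Z ^^ (2 * n)) x)"
  proof (rule CauchyI)
    fix e :: real
    assume e: "0 < e"
    then have "\<forall>\<^sub>F n in sequentially. a n < l + e\<^sup>2 / 2"
      by (intro order_tendstoD(2)[OF l(1)]) simp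
    then obtain N where N: "\<And>n. n \<ge> N \<Longrightarrow> a n < l + e\<^sup>2 / 2"
      by (auto simp: eventually_sequentially)
    have "norm ((Z ^^ (2 * i)) x - (Z ^^ (2 * j)) x) < e" if "i \<ge> N" "j \<ge> N" for i j
    proof -
      have "(norm ((Z ^^ (2 * i)) x - (Z ^^ (2 * j)) x))\<^sup>2 < e\<^sup>2"
        using dist[of i j] N[of "2 * i"] N[of "2 * j"] that by simp
      then show ?thesis
        using e by (simp add: power2_less_imp_less)
    qed
    then show "\<exists>M. \<forall>i\<ge>M. \<forall>j\<ge>M. norm ((Z ^^ (2 * i)) x - (Z ^^ (2 * j)) x) < e" by blast
  qed
  then show ?thesis
    by (rule Cauchy_convergent)
qed

section \<open>Invertibility of \<open>A\<close> and the Cauchy dual\<close>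

locale kernel_two_isometry =
  fixes T :: "'a::chilbert_space \<Rightarrow> 'a"
  assumes bounded_T: "bounded_clinear T"
    and two_isometry_T: "two_isometry T"
    and kernel_condition_T: "kernel_condition T"
begin

abbreviation Ts :: "'a \<Rightarrow> 'a" where "Ts \<equiv> adj T"

definition A :: "'a \<Rightarrow> 'a" where "A x = Ts (T x)"

definition B :: "'a \<Rightarrow> 'a" where "B = inv A"

lemma adj_T: "is_adjoint T Ts"
  by (rule is_adjoint_adj[OF bounded_T])

lemma bounded_Ts: "bounded_clinear Ts"
  by (rule bounded_clinear_adjoint[OF adj_T bounded_T])

sublocale T: bounded_linear T
  by (rule bounded_clinear_imp_bounded_linear[OF bounded_T])

sublocale Ts: bounded_linear Ts
  by (rule bounded_clinear_imp_bounded_linear[OF bounded_Ts])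

lemma cinner_T_T: "cinner (T x) (T y) = cinner x (A y)"
  by (simp add: A_def is_adjointD[OF adj_T])

lemma adj_A: "is_adjoint A A"
  unfolding A_def using is_adjoint_compose[OF is_adjoint_sym[OF adj_T] adj_T] by simp

lemma Ts_A_T: "Ts (A (T x)) = 2 *\<^sub>R A x - x"
proof -
  have "x - 2 *\<^sub>C A x + Ts (A (T x)) = 0"
    using two_isometry_T by (simp add: two_isometry_def A_def)
  moreover have "2 *\<^sub>C A x = 2 *\<^sub>R A x"
    using scaleC_of_real[of 2] by simp
  ultimately show ?thesis
    by (simp add: algebra_simps eq_neg_iff_add_eq_0)
qed

lemma norm_T_square: "(norm (T x))\<^sup>2 = Re (cinner x (A x))"
  by (simp only: Re_cinner_self[symmetric] cinner_T_T)

text \<open>The 2-isometry identity makes the square of \<open>norm ((T ^^ n) x)\<close> affine in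
  \<open>n\<close>; a nonnegative affine sequence cannot have negative slope.\<close>

lemma expansive_T: "norm x \<le> norm (T x)"
proof -
  define a where "a n = (norm ((T ^^ n) x))\<^sup>2" for n
  have "(norm (T (T y)))\<^sup>2 = 2 * (norm (T y))\<^sup>2 - (norm y)\<^sup>2" for y
  proof -
    have "(norm (T (T y)))\<^sup>2 = Re (cinner y (Ts (A (T y))))"
      by (simp only: norm_T_square is_adjointD[OF adj_T])
    also have "\<dots> = 2 * (norm (T y))\<^sup>2 - (norm y)\<^sup>2"
      by (simp add: Ts_A_T cinner.diff_right cinner_scaleR_right norm_T_square Re_cinner_self)
    finally show ?thesis .
  qed
  then have step: "a (Suc (Suc n)) = 2 * a (Suc n) - a n" for n
    by (simp add: a_def)
  have increment: "a (Suc n) - a n = a 1 - a 0" for n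
    by (induction n) (use step in auto)
  have affine: "a n = a 0 + real n * (a 1 - a 0)" for n
  proof (induction n)
    case (Suc n)
    then show ?case
      using increment[of n] by (simp add: distrib_right)
  qed simp
  have "a 0 \<le> a 1"
  proof (rule ccontr)
    assume "\<not> a 0 \<le> a 1"
    then obtain n where "a 0 < real n * (a 0 - a 1)"
      using reals_Archimedean3[of "a 0 - a 1"] by auto
    then have "a n < 0"
      unfolding affine[of n] by (simp add: algebra_simps)
    then show False
      by (simp add: a_def)
  qed
  then show ?thesis
    by (simp add: a_def)
qed

lemma bij_A: "bij A"
proof (rule bijI)
  show "inj A"
  proof (rule injI)
    fix x y
    assume "A x = A y"
    then have "A (x - y) = 0"
      by (simp add: A_def T.diff Ts.diff)
    then have "T (x - y) = 0"
      using norm_T_square[of "x - y"] by (simp add: cinner.zero_right)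
    then show "x = y"
      using expansive_T[of "x - y"] by simp
  qed
  show "surj A"
    unfolding surj_def
  proof
    fix z
    \<comment> \<open>Representing the functional \<open>Re (cinner y z)\<close> through
      \<open>T\<close> amounts to solving \<open>A x = z\<close>.\<close>
    obtain x where "\<And>y. Re (cinner (T y) (T x)) = Re (cinner y z)"
      using expansive_representation[OF T.bounded_linear_axioms expansive_T
          bounded_linear_compose[OF bounded_linear_Re cinner.bounded_linear_left]]
      by blast
    then have "A x = z"
      by (intro Re_cinner_eqI_right) (simp add: cinner_T_T)
    then show "\<exists>x. z = A x" by blast
  qed
qed

lemma A_B [simp]: "A (B x) = x" and B_A [simp]: "B (A x) = x"
  unfolding B_def using bij_A by (simp_all add: bij_is_surj surj_f_inv_f bij_is_inj inv_f_f)

text \<open>Symmetry passes from \<open>A\<close> to its inverse, and expansivity at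
  \<open>B x\<close> reads \<open>B\<^sup>2 <= B\<close>.\<close>

lemma positive_contraction_B: "positive_contraction B"
proof (rule adjoint_positive_contractionI)
  show adj: "is_adjoint B B"
    unfolding is_adjoint_def using is_adjointD[OF adj_A] by (metis A_B)
  show "(norm (B x))\<^sup>2 \<le> Re (cinner (B x) x)" for x
    using power_mono[OF expansive_T[of "B x"], of 2] by (simp add: norm_T_square)
qed

sublocale B: bounded_linear B
  by (rule positive_contraction_bounded_linear[OF positive_contraction_B])

lemmas adj_B = positive_contraction_adjoint[OF positive_contraction_B]

text \<open>\<open>I - T B T\<^sup>*\<close> maps into \<open>ker T\<^sup>*\<close>, to which the kernel condition applies.\<close>

lemma Ts_A: "Ts (A x) = 2 *\<^sub>R Ts x - B (Ts x)"
proof -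
  define y where "y = x - T (B (Ts x))"
  have "Ts y = 0"
    using A_B[of "Ts x"] by (simp add: y_def Ts.diff A_def)
  then have "Ts (A y) = 0"
    using kernel_condition_T by (simp add: kernel_condition_def A_def)
  moreover have "A y = A x - A (T (B (Ts x)))"
    by (simp add: y_def A_def T.diff Ts.diff)
  ultimately show ?thesis
    by (simp add: Ts.diff Ts_A_T)
qed

text \<open>The adjoint of \<open>Ts_A\<close>.\<close>

lemma A_T: "A (T x) = 2 *\<^sub>R T x - T (B x)"
proof (rule cinner_eqI)
  fix y
  have "cinner (A (T x)) y = cinner x (Ts (A y))"
    by (simp add: is_adjointD[OF adj_A] is_adjointD[OF adj_T])
  also have "\<dots> = cinner (2 *\<^sub>R T x - T (B x)) y"
    by (simp add: Ts_A cinner.diff_right cinner.diff_left cinner_scaleR_right cinner_scaleR_left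
        is_adjointD[OF adj_T] is_adjointD[OF adj_B])
  finally show "cinner (A (T x)) y = cinner (2 *\<^sub>R T x - T (B x)) y" .
qed

lemma cauchy_dual_eq: "cauchy_dual T = (\<lambda>x. T (B x))"
  by (simp add: cauchy_dual_def B_def A_def[abs_def] o_def)

lemma adj_cauchy_dual: "is_adjoint (cauchy_dual T) (\<lambda>x. B (Ts x))"
  unfolding cauchy_dual_eq by (rule is_adjoint_compose[OF adj_T adj_B])

lemma adj_cauchy_dual_eq: "adj (cauchy_dual T) = (\<lambda>x. B (Ts x))"
  by (rule adj_eqI[OF adj_cauchy_dual])

lemma bounded_cauchy_dual: "bounded_clinear (cauchy_dual T)"
  unfolding cauchy_dual_eq
  by (rule bounded_clinear_compose[OF bounded_T positive_contraction_bounded_clinear[OF positive_contraction_B]])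

lemma contraction_cauchy_dual: "contraction (cauchy_dual T)"
  unfolding contraction_def
proof
  fix x
  have "(norm (cauchy_dual T x))\<^sup>2 \<le> (norm x)\<^sup>2"
    using positive_contraction_upper[OF positive_contraction_B, of x]
    by (simp add: cauchy_dual_eq norm_T_square)
  then show "norm (cauchy_dual T x) \<le> norm x"
    by (simp add: power2_le_iff_abs_le)
qed

section \<open>Gram operators of the powers of \<open>T\<close> and of its dual\<close>

definition Gram :: "nat \<Rightarrow> 'a \<Rightarrow> 'a" where
  "Gram n x = real n *\<^sub>R A x - (real n - 1) *\<^sub>R x"

text \<open>Peeling off the innermost \<open>T\<close> and the outermost \<open>Ts\<close> leaves
  \<open>n (2 A - I) - (n - 1) A = (n + 1) A - n I\<close>.\<close>

lemma funpow_T_Gram: "(Ts ^^ n) ((T ^^ n) x) = Gram n x"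
proof (induction n arbitrary: x)
  case 0
  then show ?case by (simp add: Gram_def)
next
  case (Suc n)
  have "(Ts ^^ Suc n) ((T ^^ Suc n) x) = Ts (Gram n (T x))"
    by (simp add: Suc.IH funpow_swap1)
  also have "\<dots> = real n *\<^sub>R (2 *\<^sub>R A x - x) - (real n - 1) *\<^sub>R A x"
    by (simp add: Gram_def Ts.diff Ts.scaleR Ts_A_T A_def[symmetric])
  also have "\<dots> = Gram (Suc n) x"
    by (simp add: Gram_def algebra_simps flip: scaleR_2)
  finally show ?case .
qed

definition dual_Gram :: "nat \<Rightarrow> 'a \<Rightarrow> 'a" where
  "dual_Gram n x = (adj (cauchy_dual T) ^^ n) ((cauchy_dual T ^^ n) x)"

lemma dual_Gram_Gram: "dual_Gram n (Gram n x) = x"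
proof (induction n arbitrary: x)
  case 0
  then show ?case by (simp add: dual_Gram_def Gram_def)
next
  case (Suc n)
  \<comment> \<open>Both sides equal \<open>(n + 1) T x - n T (B x)\<close>, the right one by
    \<open>A_T\<close>. The leftover outer factors then cancel, since
    \<open>B (Ts (T x)) = x\<close>.\<close>
  have "cauchy_dual T (Gram (Suc n) x) = Gram n (T x)"
    by (simp add: cauchy_dual_eq Gram_def B.diff B.add B.scaleR T.diff T.add T.scaleR A_T algebra_simps
        flip: scaleR_2)
  then have "dual_Gram (Suc n) (Gram (Suc n) x) = B (Ts (dual_Gram n (Gram n (T x))))"
    by (simp add: dual_Gram_def funpow_swap1[of "cauchy_dual T"] adj_cauchy_dual_eq)
  also have "\<dots> = x"
    by (simp add: Suc.IH flip: A_def)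
  finally show ?case .
qed

text \<open>Both operators are symmetric, so taking adjoints turns the left inverse into a right
  inverse.\<close>

lemma Gram_dual_Gram: "Gram n (dual_Gram n x) = x"
proof (rule cinner_eqI)
  fix y
  have Gram: "cinner (Gram n u) v = cinner u (Gram n v)" for u v
    by (simp add: Gram_def cinner.diff_left cinner.diff_right cinner_scaleR_left cinner_scaleR_right
        is_adjointD[OF adj_A])
  have "cinner (dual_Gram n u) v = cinner u (dual_Gram n v)" for u v
    unfolding dual_Gram_def adj_cauchy_dual_eq
    using is_adjointD[OF is_adjoint_funpow[OF adj_cauchy_dual]]
      is_adjointD[OF is_adjoint_funpow[OF is_adjoint_sym[OF adj_cauchy_dual]]] by simp
  then show "cinner (Gram n (dual_Gram n x)) y = cinner x y"
    by (simp add: Gram dual_Gram_Gram)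
qed

text \<open>Injectivity of \<open>B\<close> identifies the kernel of the adjoint of the dual with
  that of \<open>Ts\<close>. There \<open>u = Ts (B x)\<close> satisfies \<open>B u = 2 u\<close>,
  which a contraction permits only for \<open>u = 0\<close>.\<close>

lemma kernel_condition_cauchy_dual: "kernel_condition (cauchy_dual T)"
  unfolding kernel_condition_def
proof (intro allI impI)
  fix x
  assume "adj (cauchy_dual T) x = 0"
  then have "Ts x = 0"
    using A_B[of "Ts x"] by (simp add: adj_cauchy_dual_eq A_def T.zero Ts.zero)
  define u where "u = Ts (B x)"
  have "2 *\<^sub>R u - B u = 0"
    using Ts_A[of "B x"] \<open>Ts x = 0\<close> by (simp add: u_def)
  then have "B u = 2 *\<^sub>R u"
    by simp
  then have "2 * norm u \<le> norm u"
    using positive_contraction_norm_le[OF positive_contraction_B, of u] by simp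
  then have "u = 0"
    by simp
  then show "adj (cauchy_dual T) (adj (cauchy_dual T) (cauchy_dual T x)) = 0"
    unfolding adj_cauchy_dual_eq unfolding cauchy_dual_eq
    using B_A[of "B x"] by (simp add: u_def B.zero A_def)
qed

end

section \<open>Subnormality of the Cauchy dual\<close>

context kernel_two_isometry
begin

text \<open>This is \<open>(2 - B)\<^sup>-\<^sup>1\<close>: since
  \<open>2 - B = (2 A - I) B\<close>, the inverse comes from the case \<open>n = 2\<close> of the
  Gram operators.\<close>

definition M :: "'a \<Rightarrow> 'a" where "M x = A (dual_Gram 2 x)"

lemma M_inverse_right: "2 *\<^sub>R M x - B (M x) = x"
  using Gram_dual_Gram[of 2 x] by (simp add: M_def Gram_def)

lemma M_inverse_left: "M (2 *\<^sub>R x - B x) = x"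
proof -
  have "2 *\<^sub>R x - B x = Gram 2 (B x)"
    by (simp add: Gram_def)
  then show ?thesis
    by (simp add: M_def dual_Gram_Gram)
qed

text \<open>Substituting \<open>x = (2 - B) M x\<close> gives symmetry at once, and
  \<open>B <= I\<close> then yields \<open>M\<^sup>2 <= M\<close>.\<close>

lemma positive_contraction_M: "positive_contraction M"
proof (rule adjoint_positive_contractionI)
  show "is_adjoint M M"
    unfolding is_adjoint_def
  proof (intro allI)
    fix x y
    have "cinner (M x) y = cinner (M x) (2 *\<^sub>R M y - B (M y))"
      by (simp only: M_inverse_right)
    also have "\<dots> = cinner (2 *\<^sub>R M x - B (M x)) (M y)"
      by (simp add: cinner.diff_left cinner.diff_right cinner_scaleR_left cinner_scaleR_right
          is_adjointD[OF adj_B])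
    also have "\<dots> = cinner x (M y)"
      by (simp only: M_inverse_right)
    finally show "cinner (M x) y = cinner x (M y)" .
  qed
  show "(norm (M x))\<^sup>2 \<le> Re (cinner (M x) x)" for x
  proof -
    have "Re (cinner (M x) x) = Re (cinner (M x) (2 *\<^sub>R M x - B (M x)))"
      by (simp only: M_inverse_right)
    also have "\<dots> = 2 * (norm (M x))\<^sup>2 - Re (cinner (B (M x)) (M x))"
      by (simp add: cinner.diff_right cinner_scaleR_right Re_cinner_self is_adjointD[OF adj_B])
    finally show ?thesis
      using positive_contraction_upper[OF positive_contraction_B, of "M x"] by linarith
  qed
qed

sublocale M: bounded_linear M
  by (rule positive_contraction_bounded_linear[OF positive_contraction_M])

text \<open>Applying \<open>A T = T (2 - B)\<close> at \<open>M x\<close> gives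
  \<open>A T M = T\<close>; then \<open>A\<close> is inverted.\<close>

lemma T_M: "T (M x) = B (T x)"
proof -
  have "A (T (M x)) = T (2 *\<^sub>R M x - B (M x))"
    by (simp add: A_T T.diff T.scaleR)
  then show ?thesis
    unfolding M_inverse_right by (metis B_A)
qed

lemma M_B: "M (B x) = B (M x)"
proof -
  have "M (B x) = M (B (2 *\<^sub>R M x - B (M x)))"
    by (simp only: M_inverse_right)
  also have "\<dots> = M (2 *\<^sub>R B (M x) - B (B (M x)))"
    by (simp only: B.diff B.scaleR)
  finally show ?thesis
    by (simp only: M_inverse_left)
qed

lemma fixed_imp_M_fixed: "B x = x \<Longrightarrow> M x = x"
  using M_inverse_left[of x] by (simp add: scaleR_2)

text \<open>Primed operators are the corresponding functions of \<open>M = (2 - B)\<^sup>-\<^sup>1\<close>, since \<open>T\<close>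
  intertwines \<open>M\<close> with \<open>B\<close>.\<close>

definition J :: "'a \<Rightarrow> 'a" where "J = sqrt_op B"
definition J' :: "'a \<Rightarrow> 'a" where "J' = sqrt_op M"
definition L :: "'a \<Rightarrow> 'a" where "L = sqrt_op (\<lambda>x. x - B x)"
definition L' :: "'a \<Rightarrow> 'a" where "L' = sqrt_op (\<lambda>x. x - M x)"

lemmas positive_contraction_IB = positive_contraction_complement[OF positive_contraction_B]
lemmas positive_contraction_IM = positive_contraction_complement[OF positive_contraction_M]

lemma positive_contraction_roots:
  "positive_contraction J" "positive_contraction J'" "positive_contraction L" "positive_contraction L'"
  unfolding J_def J'_def L_def L'_def
  by (intro positive_contraction_sqrt_op positive_contraction_B positive_contraction_M
      positive_contraction_IB positive_contraction_IM)+

sublocale J: bounded_linear J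
  by (rule positive_contraction_bounded_linear[OF positive_contraction_roots(1)])
sublocale J': bounded_linear J'
  by (rule positive_contraction_bounded_linear[OF positive_contraction_roots(2)])
sublocale L: bounded_linear L
  by (rule positive_contraction_bounded_linear[OF positive_contraction_roots(3)])

lemma J_J: "J (J x) = B x" and J'_J': "J' (J' x) = M x"
  and L_L: "L (L x) = x - B x" and L'_L': "L' (L' x) = x - M x"
  unfolding J_def J'_def L_def L'_def
  by (simp_all add: sqrt_op_square positive_contraction_B positive_contraction_M
      positive_contraction_IB positive_contraction_IM)

lemma T_J': "T (J' x) = J (T x)"
  unfolding J_def J'_def
  by (rule sqrt_op_intertwine[OF positive_contraction_M T.bounded_linear_axioms]) (rule T_M)

lemma T_L': "T (L' x) = L (T x)"
  unfolding L_def L'_def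
  by (rule sqrt_op_intertwine[OF positive_contraction_IM T.bounded_linear_axioms])
    (simp add: T.diff T_M)

lemma B_J: "B (J x) = J (B x)"
  unfolding J_def by (rule sqrt_op_intertwine[OF positive_contraction_B B.bounded_linear_axioms]) simp

lemma B_J': "B (J' x) = J' (B x)"
  unfolding J'_def
  by (rule sqrt_op_intertwine[OF positive_contraction_M B.bounded_linear_axioms]) (simp add: M_B)

lemma M_J': "M (J' x) = J' (M x)"
  unfolding J'_def by (rule sqrt_op_intertwine[OF positive_contraction_M M.bounded_linear_axioms]) simp

lemma B_L: "B (L x) = L (B x)"
  unfolding L_def
  by (rule sqrt_op_intertwine[OF positive_contraction_IB B.bounded_linear_axioms]) (simp add: B.diff)

lemma M_L: "M (L x) = L (M x)"
  unfolding L_def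
  by (rule sqrt_op_intertwine[OF positive_contraction_IB M.bounded_linear_axioms])
    (simp add: M.diff M_B)

lemma J'_L: "J' (L x) = L (J' x)"
  unfolding L_def
  by (rule sqrt_op_intertwine[OF positive_contraction_IB J'.bounded_linear_axioms])
    (simp add: J'.diff B_J')

text \<open>\<open>sqrt (1 - M) = sqrt M * sqrt (1 - B)\<close> since \<open>1 - M = M (1 - B)\<close>.\<close>

lemma L'_eq: "L' x = J' (L x)"
proof (rule positive_square_root_unique[OF positive_contraction_roots(4)])
  show "positive_contraction (\<lambda>x. J' (L x))"
    by (rule positive_contraction_compose[OF positive_contraction_roots(2,3) J'_L])
  show "L' (J' (L x)) = J' (L (L' x))" for x
    unfolding L'_def
    by (rule sqrt_op_intertwine[symmetric, OF positive_contraction_IM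
          bounded_linear_compose[OF J'.bounded_linear_axioms L.bounded_linear_axioms]])
      (simp add: L.diff J'.diff M_J' M_L)
  show "L' (L' x) = J' (L (J' (L x)))" for x
  proof -
    have "J' (L (J' (L x))) = M (x - B x)"
      by (simp only: J'_L[symmetric] J'_J' L_L)
    also have "\<dots> = x - M x"
    proof -
      have "2 *\<^sub>R M x - M (B x) = x"
        using M_inverse_left[of x] by (simp only: M.diff M.scaleR)
      then show ?thesis
        by (simp add: M.diff scaleR_2 algebra_simps)
    qed
    finally show ?thesis
      by (simp add: L'_L')
  qed
qed

text \<open>Moving the roots through \<open>T\<close> primes them, and
  \<open>J' L' = J' J' L = M L\<close>. This is how \<open>G\<close> is carried past
  \<open>T\<close> in \<open>matrix_op_v\<close>.\<close>

lemma J_L_T: "J (L (T x)) = T (M (L x))"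
  by (simp flip: T_J' T_L') (simp add: L'_eq J'_J')

text \<open>The isometric factor in the polar decomposition of \<open>T\<close>, as \<open>J\<close>
  is the inverse square root of \<open>A\<close>.\<close>

definition W :: "'a \<Rightarrow> 'a" where "W x = T (J x)"

lemma bounded_W: "bounded_clinear W"
  unfolding W_def[abs_def]
  by (rule bounded_clinear_compose[OF bounded_T
        positive_contraction_bounded_clinear[OF positive_contraction_roots(1)]])

lemma adj_W: "is_adjoint W (\<lambda>x. J (Ts x))"
  unfolding W_def[abs_def]
  by (rule is_adjoint_compose[OF adj_T positive_contraction_adjoint[OF positive_contraction_roots(1)]])

lemma isometry_W: "J (Ts (W x)) = x"
proof -
  have "J (A (J x)) = A (J (J x))"
    by (metis A_B B_A B_J)
  then show ?thesis
    by (simp add: W_def J_J flip: A_def)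
qed

section \<open>The spectral variable \<open>Z\<close>, rescaled to [-1, 1], and its limit
  projection\<close>

definition Z :: "'a \<Rightarrow> 'a" where "Z x = 2 *\<^sub>R B x - x"

lemma bounded_Z: "bounded_clinear Z"
  unfolding Z_def[abs_def]
  by (rule bounded_clinear_diff[OF bounded_clinear_scaleR
        [OF positive_contraction_bounded_clinear[OF positive_contraction_B]] bounded_clinear_ident])

sublocale Z: bounded_linear Z
  by (rule bounded_clinear_imp_bounded_linear[OF bounded_Z])

lemma adj_Z: "is_adjoint Z Z"
  unfolding Z_def[abs_def]
  by (rule is_adjoint_diff[OF is_adjoint_scaleR[OF adj_B] is_adjoint_ident])

text \<open>Expanding the square leaves \<open>I - Z\<^sup>2 = 4 (B - B\<^sup>2)\<close>, which is
  nonnegative.\<close>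

lemma contraction_Z: "norm (Z x) \<le> norm x"
proof -
  have "(norm (Z x))\<^sup>2 = 4 * (norm (B x))\<^sup>2 - 4 * Re (cinner (B x) x) + (norm x)\<^sup>2"
    by (simp add: Z_def norm_diff_square cinner_scaleR_left power_mult_distrib)
  also have "\<dots> \<le> (norm x)\<^sup>2"
    using positive_contraction_norm_square_le[OF positive_contraction_B, of x] by simp
  finally show ?thesis
    by (simp add: power2_le_iff_abs_le)
qed

lemma funpow_Z_norm_le: "norm ((Z ^^ n) x) \<le> norm x"
  by (induction n) (auto intro: order_trans[OF contraction_Z])

lemma cinner_funpow_Z: "cinner ((Z ^^ n) x) y = cinner x ((Z ^^ n) y)"
  by (rule is_adjointD[OF is_adjoint_funpow[OF adj_Z]])

lemma bounded_funpow_Z: "bounded_clinear (Z ^^ n)"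
  by (rule bounded_clinear_funpow[OF bounded_Z])

text \<open>The orthogonal projection onto \<open>ker (I - B)\<close>, built without spectral
  measures: even powers of \<open>Z\<close> survive only at the spectral points 1 and -1, and -1
  would mean \<open>B x = 0\<close>.\<close>

definition P :: "'a \<Rightarrow> 'a" where "P x = lim (\<lambda>n. (Z ^^ (2 * n)) x)"

lemma P_limit: "(\<lambda>n. (Z ^^ (2 * n)) x) \<longlonglongrightarrow> P x"
  unfolding P_def using even_powers_converge[OF adj_Z contraction_Z]
  by (simp add: convergent_LIMSEQ_iff)

lemma P_adjoint: "cinner (P x) y = cinner x (P y)"
proof (rule LIMSEQ_unique)
  show "(\<lambda>n. cinner ((Z ^^ (2 * n)) x) y) \<longlonglongrightarrow> cinner (P x) y"
    by (intro cinner.tendsto P_limit tendsto_const)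
  show "(\<lambda>n. cinner ((Z ^^ (2 * n)) x) y) \<longlonglongrightarrow> cinner x (P y)"
    unfolding cinner_funpow_Z by (intro cinner.tendsto P_limit tendsto_const)
qed

lemma P_add: "P (x + y) = P x + P y"
  by (rule cinner_eqI) (simp add: P_adjoint cinner_add_left)

lemma P_scaleC: "P (c *\<^sub>C x) = c *\<^sub>C P x"
  by (rule cinner_eqI) (simp add: P_adjoint cinner_scaleC_left)

text \<open>The limit is fixed by \<open>Z\<^sup>2\<close>, which says \<open>B\<^sup>2 = B\<close>
  on the range of \<open>P\<close>; cancelling the invertible \<open>B\<close> rules out the
  eigenvalue -1 of \<open>Z\<close>.\<close>

lemma B_P: "B (P x) = P x"
proof -
  have "(\<lambda>n. Z (Z ((Z ^^ (2 * n)) x))) \<longlonglongrightarrow> Z (Z (P x))"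
    by (intro Z.tendsto P_limit)
  moreover have "(\<lambda>n. Z (Z ((Z ^^ (2 * n)) x))) \<longlonglongrightarrow> P x"
    using LIMSEQ_Suc[OF P_limit[of x]] by simp
  ultimately have "Z (Z (P x)) = P x"
    by (rule LIMSEQ_unique)
  then have "B (B (P x)) = B (P x)"
    by (simp add: Z_def B.diff B.scaleR scaleR_diff_right algebra_simps flip: scaleR_2)
  then show ?thesis
    by (metis A_B)
qed

lemma P_fixed:
  assumes "B x = x"
  shows "P x = x"
proof -
  have "(Z ^^ n) x = x" for n
    by (induction n) (simp_all add: Z_def assms scaleR_2)
  then show ?thesis
    by (simp add: P_def)
qed

text \<open>Both \<open>T\<close> and \<open>T\<^sup>*\<close> leave \<open>ker (I - B)\<close> invariant, hence commute with \<open>P\<close>.\<close>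

lemma P_T: "P (T x) = T (P x)"
proof (rule cinner_eqI)
  fix y
  have PTP: "P (T (P x)) = T (P x)" for x
    by (rule P_fixed) (simp add: fixed_imp_M_fixed B_P flip: T_M)
  have PTsP: "P (Ts (P y)) = Ts (P y)" for y
  proof (rule P_fixed)
    have "A (P y) = P y"
      by (metis A_B B_P)
    then show "B (Ts (P y)) = Ts (P y)"
      using Ts_A[of "P y"] by (simp add: scaleR_2)
  qed
  have "cinner (P (T x)) y = cinner x (P (Ts (P y)))"
    by (simp add: P_adjoint is_adjointD[OF adj_T] PTsP)
  also have "\<dots> = cinner (P (T (P x))) y"
    by (simp add: P_adjoint[symmetric] is_adjointD[OF adj_T, symmetric])
  finally show "cinner (P (T x)) y = cinner (T (P x)) y"
    by (simp add: PTP)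
qed

lemma P_B: "P (B x) = P x"
  by (rule cinner_eqI) (simp add: P_adjoint is_adjointD[OF adj_B] B_P)

text \<open>As \<open>J\<^sup>2\<close> fixes \<open>P x\<close>, the defect \<open>v\<close>
  satisfies \<open>J v = - v\<close>, impossible for positive \<open>J\<close> unless
  \<open>v = 0\<close>.\<close>

lemma J_P: "J (P x) = P x"
proof -
  define v where "v = J (P x) - P x"
  have "J v = - v"
    by (simp add: v_def J.diff J_J B_P)
  then have "(norm v)\<^sup>2 \<le> 0"
    using positive_contraction_nonneg[OF positive_contraction_roots(1), of v]
    by (simp add: cinner.minus_left Re_cinner_self)
  then show ?thesis
    by (simp add: v_def)
qed

text \<open>In terms of the spectral variable \<open>z\<close> of \<open>Z\<close>, the sequence \<open>Q k\<close> is the normalised Szegoe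
  kernel \<open>sqrt (1 - z\<^sup>2) z ^ k\<close>.\<close>

definition G :: "'a \<Rightarrow> 'a" where "G x = 2 *\<^sub>R J (L x)"

definition Q :: "nat \<Rightarrow> 'a \<Rightarrow> 'a" where "Q k x = G ((Z ^^ k) x)"

lemma bounded_G: "bounded_clinear G"
  unfolding G_def[abs_def]
  by (rule bounded_clinear_scaleR[OF bounded_clinear_compose[OF
        positive_contraction_roots(1,3)[THEN positive_contraction_bounded_clinear]]])

sublocale G: bounded_linear G
  by (rule bounded_clinear_imp_bounded_linear[OF bounded_G])

lemma bounded_Q: "bounded_clinear (Q k)"
  unfolding Q_def[abs_def] by (rule bounded_clinear_compose[OF bounded_G bounded_funpow_Z])

text \<open>This is \<open>G\<^sup>2 = 4 B (I - B) = I - Z\<^sup>2\<close>, the form in which the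
  sum over \<open>Q k\<close> telescopes.\<close>

lemma cinner_G_G: "cinner (G x) (G y) = cinner x y - cinner (Z x) (Z y)"
proof -
  have "cinner (G x) (G y) = 4 *\<^sub>R cinner (J (L x)) (J (L y))"
    by (simp add: G_def cinner_scaleR_left cinner_scaleR_right)
  also have "cinner (J (L x)) (J (L y)) = cinner (B (x - B x)) y"
    by (simp add: is_adjointD[OF positive_contraction_adjoint[OF positive_contraction_roots(1)]]
        is_adjointD[OF positive_contraction_adjoint[OF positive_contraction_roots(3)]]
        is_adjointD[OF adj_B] B.diff J_J cinner.diff_left cinner.diff_right B_L L_L)
  also have "4 *\<^sub>R cinner (B (x - B x)) y = cinner x y - cinner (Z x) (Z y)"
    by (simp add: Z_def B.diff cinner.diff_left cinner.diff_right cinner_scaleR_left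
        cinner_scaleR_right is_adjointD[OF adj_B] scaleR_conv_of_real)
  finally show ?thesis .
qed

text \<open>A telescoping series: the first term is \<open>cinner x y\<close>, and the remainder
  \<open>cinner ((Z ^^ n) x) ((Z ^^ n) y)\<close> tends to
  \<open>cinner (P x) (P y)\<close>.\<close>

lemma Q_inner_sums: "(\<lambda>k. cinner (Q k x) (Q k y)) sums (cinner x y - cinner (P x) (P y))"
proof -
  have "(\<lambda>n. cinner ((Z ^^ n) x) ((Z ^^ n) y)) \<longlonglongrightarrow> cinner (P x) y"
  proof -
    have "cinner ((Z ^^ n) x) ((Z ^^ n) y) = cinner ((Z ^^ (2 * n)) x) y" for n
      by (simp add: cinner_funpow_Z[symmetric] mult_2 funpow_add)
    then show ?thesis
      using cinner.tendsto[OF P_limit[of x] tendsto_const[of y]] by simp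
  qed
  moreover have "cinner (P x) y = cinner (P x) (P y)"
    by (simp add: P_adjoint P_fixed[OF B_P])
  ultimately have "(\<lambda>n. cinner ((Z ^^ n) x) ((Z ^^ n) y)) \<longlonglongrightarrow> cinner (P x) (P y)"
    by simp
  from telescope_sums'[OF this] show ?thesis
    by (simp add: Q_def cinner_G_G)
qed

text \<open>The embedding into sequences. Position 0 restores the part \<open>P x\<close> missing
  from the \<open>Q k x\<close>, in line with the extra block of
  \<open>extended_laguerre_matrix\<close>.\<close>

definition v :: "'a \<Rightarrow> nat \<Rightarrow> 'a" where "v x n = (case n of 0 \<Rightarrow> P x | Suc k \<Rightarrow> Q k x)"

lemma v_simps [simp]: "v x 0 = P x" "v x (Suc k) = Q k x"
  by (simp_all add: v_def)

lemma v_l2seq: "v x \<in> l2seq"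
proof (rule l2seqI)
  have "(\<lambda>k. Re (cinner (Q k x) (Q k x))) sums Re (cinner x x - cinner (P x) (P x))"
    by (rule sums_Re[OF Q_inner_sums])
  then have "summable (\<lambda>k. (norm (v x (Suc k)))\<^sup>2)"
    by (simp add: Re_cinner_self sums_iff)
  then show "summable (\<lambda>n. (norm (v x n))\<^sup>2)"
    by (subst (asm) summable_Suc_iff)
qed

lemma l2inner_v: "l2inner (v x) (v y) = cinner x y"
  unfolding l2inner_def
  using suminf_split_head[OF summable_l2inner(2)[OF v_l2seq v_l2seq], of x y] sums_unique[OF Q_inner_sums[of x y]]
  by simp

lemma v_add: "v (x + y) n = v x n + v y n"
  using bounded_Q unfolding bounded_clinear_def by (cases n) (simp_all add: P_add)

lemma v_scaleC: "v (c *\<^sub>C x) n = c *\<^sub>C v x n"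
  using bounded_Q unfolding bounded_clinear_def by (cases n) (simp_all add: P_scaleC)

definition MB :: "'a \<Rightarrow> 'a" where "MB x = M (B x)"

text \<open>Since \<open>3 - Z = 2 (2 - B)\<close> and \<open>I + Z = 2 B\<close>, the factors
  \<open>2 / (3 - Z)\<close> and \<open>(1 + Z) / (3 - Z)\<close> of the row generating function
  become \<open>M\<close> and \<open>MB\<close>.\<close>

lemma laguerre_matrix_Z:
  "(\<Sum>j. laguerre_matrix k j *\<^sub>R (Z ^^ j) x) = (MB ^^ k) (M x)"
proof -
  let ?y = "\<lambda>k. \<Sum>j. laguerre_matrix k j *\<^sub>R (Z ^^ j) x"
  note calculus = laguerre_matrix_functional_calculus[OF Z.bounded_linear_axioms funpow_Z_norm_le]
  have solve: "y = M w" if "3 *\<^sub>R y - Z y = 2 *\<^sub>R w" for y w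
  proof -
    have "3 *\<^sub>R y - Z y = 2 *\<^sub>R (2 *\<^sub>R y - B y)"
      using scaleR_left_distrib[of 1 3 y] by (simp add: Z_def scaleR_diff_right algebra_simps)
    then have "2 *\<^sub>R y - B y = w"
      using that by simp
    then show ?thesis
      using M_inverse_left[of y] by simp
  qed
  show ?thesis
  proof (induction k)
    case 0
    then show ?case
      using solve[OF calculus(1)] by simp
  next
    case (Suc k)
    have "3 *\<^sub>R ?y (Suc k) - Z (?y (Suc k)) = 2 *\<^sub>R B (?y k)"
      unfolding calculus(2) by (simp add: Z_def)
    from solve[OF this] show ?case
      by (simp add: Suc.IH MB_def)
  qed
qed

text \<open>The embedding intertwines the dual with the matrix tensored with \<open>W\<close>. At
  position 0 this is \<open>W P = P T B\<close>; at later positions the row formula turns into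
  powers of \<open>MB\<close>, which \<open>T\<close> converts into powers of
  \<open>Z\<close>.\<close>

lemma matrix_op_v:
  "matrix_op extended_laguerre_matrix (\<lambda>n. W (v x n)) = v (cauchy_dual T x)"
proof
  fix n
  have "matrix_op extended_laguerre_matrix (\<lambda>n. W (v x n)) n =
      W (matrix_op extended_laguerre_matrix (v x) n)"
    by (rule matrix_op_bounded_linear[OF symmetric_stochastic_extended_laguerre_matrix v_l2seq bounded_W, symmetric])
  also have "\<dots> = v (cauchy_dual T x) n"
  proof (cases n)
    case 0
    then show ?thesis
      by (simp add: matrix_op_extended_laguerre_matrix W_def J_P cauchy_dual_eq P_T P_B)
  next
    case (Suc k)
    define u where "u = (MB ^^ k) x"
    have comm: "(MB ^^ k) (M x) = M u" "(MB ^^ k) (B x) = B u"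
      unfolding u_def by (rule funpow_intertwine[symmetric]; simp add: MB_def M_B)+
    have "matrix_op extended_laguerre_matrix (v x) n = (\<Sum>j. G (laguerre_matrix k j *\<^sub>R (Z ^^ j) x))"
      by (simp add: Suc matrix_op_extended_laguerre_matrix(2)[OF v_l2seq] Q_def G.scaleR)
    also have "\<dots> = G (\<Sum>j. laguerre_matrix k j *\<^sub>R (Z ^^ j) x)"
      by (intro G.suminf[symmetric] summable_scaleR_bounded(2)[OF summable_laguerre_matrix
            laguerre_matrix_nonneg funpow_Z_norm_le])
    also have "\<dots> = G (M u)"
      by (simp only: laguerre_matrix_Z comm)
    finally have "W (matrix_op extended_laguerre_matrix (v x) n) = 2 *\<^sub>R T (B (L (M u)))"
      by (simp add: W_def G_def J.scaleR T.scaleR J_J)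
    also have "\<dots> = 2 *\<^sub>R T (M (L (B u)))"
      by (simp add: M_L B_L M_B)
    also have "\<dots> = G (T (B u))"
      by (simp add: G_def J_L_T)
    also have "\<dots> = Q k (T (B x))"
    proof -
      \<comment> \<open>From \<open>(2 - B) M = I\<close> one has \<open>M B = 2 M - I\<close>, and
        \<open>T M = B T\<close> turns this into \<open>2 B - I = Z\<close> on the other side of
        \<open>T\<close>.\<close>
      have "T (MB z) = Z (T z)" for z
        using M_inverse_right[of z]
        by (simp add: Z_def MB_def M_B T_M[symmetric] flip: T.scaleR T.diff) (simp add: algebra_simps)
      then have "T ((MB ^^ k) z) = (Z ^^ k) (T z)" for z
        by (rule funpow_intertwine)
      then show ?thesis
        by (simp add: Q_def flip: comm)
    qed
    finally show ?thesis
      by (simp add: Suc cauchy_dual_eq)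
  qed
  finally show "matrix_op extended_laguerre_matrix (\<lambda>n. W (v x n)) n = v (cauchy_dual T x) n" .
qed

lemma subnormal_cauchy_dual: "subnormal_op (cauchy_dual T)"
proof -
  obtain N :: "(nat \<Rightarrow> 'a) \<Rightarrow> nat \<Rightarrow> 'a" where N: "normal_op_l2 N"
    "\<And>f. f \<in> l2seq \<Longrightarrow> N (interleave f (\<lambda>n. 0)) =
      interleave (matrix_op extended_laguerre_matrix (\<lambda>n. W (f n))) (\<lambda>n. 0)"
    using isometry_tensor_stochastic_normal_extension
      [OF symmetric_stochastic_extended_laguerre_matrix bounded_W adj_W isometry_W] by blast
  \<comment> \<open>The space is placed in the first summand, at the even positions, which the
    unitary extension leaves invariant and where it acts as \<open>W\<close>.\<close>
  define V where "V x = interleave (v x) (\<lambda>n. 0)" for x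
  have V: "V x \<in> l2seq" for x
    unfolding V_def by (rule l2seq_interleave[OF v_l2seq l2seq_zero])
  have "V (x + y) = (\<lambda>n. V x n + V y n)" for x y
    unfolding V_def interleave_pointwise2[symmetric] by (simp add: v_add[abs_def])
  moreover have "V (c *\<^sub>C x) = (\<lambda>n. c *\<^sub>C V x n)" for c x
    unfolding V_def interleave_pointwise[symmetric] by (simp add: v_scaleC[abs_def])
  moreover have "l2inner (V x) (V y) = cinner x y" for x y
    unfolding l2inner_evens_odds[OF V V] by (simp add: V_def l2inner_v) (simp add: l2inner_def cinner.zero_left)
  moreover have "N (V x) = V (cauchy_dual T x)" for x
    by (simp add: V_def N(2)[OF v_l2seq] matrix_op_v)
  ultimately show ?thesis
    unfolding subnormal_op_def using bounded_cauchy_dual V N(1) by blast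
qed

end

theorem mainTheorem1:
  fixes T :: "'a::chilbert_space \<Rightarrow> 'a"
  assumes "bounded_clinear T"
    and "two_isometry T"
    and "kernel_condition T"
  shows "subnormal_op (cauchy_dual T) \<and> contraction (cauchy_dual T) \<and>
         kernel_condition (cauchy_dual T) \<and>
         (\<forall>n::nat.
            is_inverse_of ((adj (cauchy_dual T) ^^ n) \<circ> (cauchy_dual T ^^ n))
              (\<lambda>x. of_nat n *\<^sub>C adj T (T x) - (of_nat n - 1) *\<^sub>C x) \<and>
            is_inverse_of ((adj (cauchy_dual T) ^^ n) \<circ> (cauchy_dual T ^^ n))
              ((adj T ^^ n) \<circ> (T ^^ n)))"
proof -
  interpret kernel_two_isometry T
    using assms by unfold_locales
  have coeff: "of_nat n *\<^sub>C x = real n *\<^sub>R x" "(of_nat n - 1) *\<^sub>C x = (real n - 1) *\<^sub>R x" for n and x :: 'a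
    by (simp_all flip: scaleC_of_real)
  have "(\<lambda>x. of_nat n *\<^sub>C adj T (T x) - (of_nat n - 1) *\<^sub>C x) = Gram n" for n
    by (simp add: coeff Gram_def[abs_def] A_def)
  moreover have "(adj T ^^ n) \<circ> (T ^^ n) = Gram n" for n
    by (simp add: fun_eq_iff funpow_T_Gram)
  moreover have "is_inverse_of ((adj (cauchy_dual T) ^^ n) \<circ> (cauchy_dual T ^^ n)) (Gram n)" for n
  proof -
    have "(adj (cauchy_dual T) ^^ n) \<circ> (cauchy_dual T ^^ n) = dual_Gram n"
      by (simp add: fun_eq_iff dual_Gram_def)
    then show ?thesis
      by (simp add: is_inverse_of_def fun_eq_iff dual_Gram_Gram Gram_dual_Gram)
  qed
  ultimately show ?thesis
    using subnormal_cauchy_dual contraction_cauchy_dual kernel_condition_cauchy_dual by simp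
qed

end
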